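(* For every Polish set $B\in\mathcal B(\mathbb R^d)$ and all $\mathbf P_0,\mathbf P_1\in\mathcal P_1(\Gamma_B)$ there exists a solution $(\bar{\mathbf P},\bar{\mathbf V})\in\mathcal{CE}^B(\mathbf P_0,\mathbf P_1)$ of the continuity equation on $B$ joining $\mathbf P_0$ to $\mathbf P_1$. Moreover, if $\mathbf P_0,\mathbf P_1\in\mathcal P_s(\Gamma_{\mathbb R^d})$ are stationary, then there exists a stationary solution $(\bar{\mathbf P}^s,\bar{\mathbf V}^s)\in\mathcal{CE}^s(\mathbf P_0,\mathbf P_1)$.
   Context: Configurations. For a Borel set $B\subseteq\mathbb R^d$ that is Polish in the subspace topology, $\mathcal B_0(B)$ denotes the bounded Borel subsets of $B$, and $\Gamma_B$ the space of locally finite simple counting measures on $B$ with the vague topology (generated by $\xi\mapsto\int f\,d\xi$, $f\in\mathcal C_c(B)$) and its Borel $\sigma$-algebra. $\mathcal P_1(\Gamma_B)$ is the set of Borel probability measures $\mathbf P$ on $\Gamma_B$ with $\int\xi(D)\,\mathbf P(d\xi)<\infty$ for all $D\in\mathcal B_0(B)$. It carries the topology generated by the maps $\mathbf P\mapsto\int F\,d\mathbf P$, where $F:\Gamma_B\to\mathbb R$ ranges over continuous functions of sublinear growth, i.e. $|F(\xi)|\le c(1+\int f\,d\xi)$ for some $c>0$, $f\in\mathcal C_c(B)$. Shifts. $\Theta_z\xi(A)=\xi(A+z)$ for $\xi\in\Gamma_{\mathbb R^d}$, $z\in\mathbb R^d$. $\mathcal P_s(\Gamma_{\mathbb R^d})$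 is the set of $\mathbf P\in\mathcal P_1(\Gamma_{\mathbb R^d})$ with $(\Theta_z)_\#\mathbf P=\mathbf P$ for all $z$. Velocity fields. $\mathcal M_{b,0}(\Gamma_B\times B)$ is the set of signed measures $\mathbf V$ on $\Gamma_B\times B$ with $|\mathbf V|(\Gamma_B\times D)<\infty$ for all $D\in\mathcal B_0(B)$. Such a $\mathbf V$ on $\Gamma_{\mathbb R^d}\times\mathbb R^d$ is stationary, written $\mathbf V\in\mathcal M_s(\Gamma_{\mathbb R^d}\times\mathbb R^d)$, if it is invariant under push-forward by $(\xi,x)\mapsto(\Theta_z\xi,x-z)$ for all $z\in\mathbb R^d$. Difference operator. $D_zF(\xi)=F(\xi+\delta_z)-F(\xi)$. Continuity equation. $\mathcal{CE}^B(\mathbf P_0,\mathbf P_1)$ is the set of pairs $(\bar{\mathbf P},\bar{\mathbf V})=(\bar{\mathbf P}_t,\bar{\mathbf V}_t)_{t\in[0,1]}$ with $\bar{\mathbf P}_t\in\mathcal P_1(\Gamma_B)$, $\bar{\mathbf V}_t\in\mathcal M_{b,0}(\Gamma_B\times B)$ such that: (i) $\bar{\mathbf P}_0=\mathbf P_0$, $\bar{\mathbf P}_1=\mathbf P_1$; (ii) $t\mapsto\bar{\mathbf P}_t$ is continuous in $\mathcal P_1(\Gamma_B)$; (iii) for all $\phi\in\mathcal C_c^\infty((0,1))$ and all non-negative $f\in\mathcal C_c(B)$, $$\int_0^1\phi'(t)\int e^{-\int f\,d\xi}\,\bar{\mathbf P}_t(d\xi)\,dt+\int_0^1\phi(t)\int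 D_z e^{-\int f\,d\xi}\,\bar{\mathbf V}_t(d\xi,dz)\,dt=0;$$ (iv) $\int_0^1|\bar{\mathbf V}_t|(\Gamma_B\times D)\,dt<\infty$ for all $D\in\mathcal B_0(B)$. For $\mathbf P_0,\mathbf P_1\in\mathcal P_s(\Gamma_{\mathbb R^d})$, $\mathcal{CE}^s(\mathbf P_0,\mathbf P_1)$ is the set of $(\bar{\mathbf P},\bar{\mathbf V})\in\mathcal{CE}^{\mathbb R^d}(\mathbf P_0,\mathbf P_1)$ with $\bar{\mathbf V}_t\in\mathcal M_s(\Gamma_{\mathbb R^d}\times\mathbb R^d)$ for all $t\in[0,1]$. *)

theory Defs
  imports "HOL-Probability.Probability"
begin

definition polish_set :: "'a::topological_space set \<Rightarrow> bool" where
  "polish_set B \<longleftrightarrow>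
     separable_space (top_of_set B) \<and> completely_metrizable_space (top_of_set B)"

definition bounded_borel :: "'a::euclidean_space set \<Rightarrow> 'a set set" where
  "bounded_borel B = {D \<in> sets (restrict_space borel B). bounded D}"

text \<open>Functions on \<open>B\<close> are total functions of which only the values on \<open>B\<close> matter. The support
  is the closure relative to \<open>B\<close>, and it has to be a compact subset of \<open>B\<close>.\<close>

definition Cc :: "'a::euclidean_space set \<Rightarrow> ('a \<Rightarrow> real) set" where
  "Cc B = {f. continuous_on B f \<and> compact (B \<inter> closure {x \<in> B. f x \<noteq> 0})}"

definition Cc_smooth_01 :: "(real \<Rightarrow> real) set" where
  "Cc_smooth_01 = {\<phi>. (\<forall>n t. (deriv ^^ n) \<phi> differentiable (at t))
                       \<and> closure {t. \<phi> t \<noteq> 0} \<subseteq> {0<..<1}}"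


section \<open>Configurations\<close>

text \<open>A locally finite counting measure takes values in \<open>\<nat>\<close> (in particular finite ones) on bounded
  Borel sets; it is simple if no point has mass larger than one.\<close>

definition Config :: "'a::euclidean_space set \<Rightarrow> 'a measure set" where
  "Config B = {\<xi>. sets \<xi> = sets (restrict_space borel B)
                 \<and> (\<forall>D\<in>bounded_borel B. emeasure \<xi> D \<in> \<nat>)
                 \<and> (\<forall>x\<in>B. emeasure \<xi> {x} \<le> 1)}"

definition vague_topology :: "'a::euclidean_space set \<Rightarrow> 'a measure topology" where
  "vague_topology B = topology_generated_by
     {{\<xi> \<in> Config B. (\<integral>x. f x \<partial>\<xi>) \<in> U} | f U. f \<in> Cc B \<and> open U}"

definition config_algebra :: "'a::euclidean_space set \<Rightarrow> 'a measure measure" where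
  "config_algebra B = sigma (Config B) {G. openin (vague_topology B) G}"

lemma topspace_vague_topology [simp]: "topspace (vague_topology B) = Config B"
proof -
  have "(\<lambda>_. 0) \<in> Cc B"
    by (simp add: Cc_def)
  then show ?thesis
    unfolding vague_topology_def topology_generated_by_topspace by blast
qed

lemma config_algebra_subset: "{G. openin (vague_topology B) G} \<subseteq> Pow (Config B)"
  using openin_subset by fastforce

lemma space_config_algebra [simp]: "space (config_algebra B) = Config B"
  by (simp add: config_algebra_def config_algebra_subset)

lemma sets_config_algebra:
  "sets (config_algebra B) = sigma_sets (Config B) {G. openin (vague_topology B) G}"
  by (simp add: config_algebra_def config_algebra_subset)

definition P1 :: "'a::euclidean_space set \<Rightarrow> 'a measure measure set" where
  "P1 B = {P. prob_space P \<and> sets P = sets (config_algebra B)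
             \<and> (\<forall>D\<in>bounded_borel B. (\<integral>\<^sup>+\<xi>. emeasure \<xi> D \<partial>P) < \<infinity>)}"

definition sublinear_growth :: "'a::euclidean_space set \<Rightarrow> ('a measure \<Rightarrow> real) \<Rightarrow> bool" where
  "sublinear_growth B F \<longleftrightarrow>
     (\<exists>c>0. \<exists>f\<in>Cc B. \<forall>\<xi>\<in>Config B. \<bar>F \<xi>\<bar> \<le> c * (1 + (\<integral>x. f x \<partial>\<xi>)))"

definition P1_topology :: "'a::euclidean_space set \<Rightarrow> 'a measure measure topology" where
  "P1_topology B = topology_generated_by
     {{P \<in> P1 B. (\<integral>\<xi>. F \<xi> \<partial>P) \<in> U} | F U.
        continuous_map (vague_topology B) euclideanreal F \<and> sublinear_growth B F \<and> open U}"

text \<open>\<open>shift z \<xi>\<close> is the configuration \<open>A \<mapsto> \<xi> (A + z)\<close>.\<close>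

definition shift :: "'a::euclidean_space \<Rightarrow> 'a measure \<Rightarrow> 'a measure" where
  "shift z \<xi> = distr \<xi> borel (\<lambda>x. x - z)"

definition Ps :: "'a::euclidean_space measure measure set" where
  "Ps = {P \<in> P1 UNIV. \<forall>z. distr P (config_algebra UNIV) (shift z) = P}"


section \<open>Velocity fields\<close>

text \<open>A velocity field may have infinite positive and infinite negative mass at the same time, so it
  is a real-valued, countably additive function on the ring of those measurable sets that lie over
  some bounded part of \<open>B\<close>; its values off this ring are irrelevant.\<close>

definition field_algebra :: "'a::euclidean_space set \<Rightarrow> ('a measure \<times> 'a) measure" where
  "field_algebra B = config_algebra B \<Otimes>\<^sub>M restrict_space borel B"

definition local_sets :: "'a::euclidean_space set \<Rightarrow> ('a measure \<times> 'a) set set" where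
  "local_sets B = {A \<in> sets (field_algebra B). \<exists>D\<in>bounded_borel B. A \<subseteq> Config B \<times> D}"

definition signed_measure_on :: "'b set set \<Rightarrow> ('b set \<Rightarrow> real) \<Rightarrow> bool" where
  "signed_measure_on R V \<longleftrightarrow> V {} = 0 \<and>
     (\<forall>A :: nat \<Rightarrow> 'b set. range A \<subseteq> R \<longrightarrow> disjoint_family A \<longrightarrow> (\<Union>n. A n) \<in> R \<longrightarrow>
        (\<lambda>n. V (A n)) sums V (\<Union>n. A n))"

text \<open>Jordan's upper and lower variation; note that \<^const>\<open>ennreal\<close> maps negative reals to \<open>0\<close>.\<close>

definition upper_variation :: "'b set set \<Rightarrow> ('b set \<Rightarrow> real) \<Rightarrow> 'b set \<Rightarrow> ennreal" where
  "upper_variation R V A = (SUP C\<in>{C \<in> R. C \<subseteq> A}. ennreal (V C))"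

definition lower_variation :: "'b set set \<Rightarrow> ('b set \<Rightarrow> real) \<Rightarrow> 'b set \<Rightarrow> ennreal" where
  "lower_variation R V A = (SUP C\<in>{C \<in> R. C \<subseteq> A}. ennreal (- V C))"

definition total_variation :: "'b set set \<Rightarrow> ('b set \<Rightarrow> real) \<Rightarrow> 'b set \<Rightarrow> ennreal" where
  "total_variation R V A = upper_variation R V A + lower_variation R V A"

definition Mb0 :: "'a::euclidean_space set \<Rightarrow> (('a measure \<times> 'a) set \<Rightarrow> real) set" where
  "Mb0 B = {V. signed_measure_on (local_sets B) V
              \<and> (\<forall>D\<in>bounded_borel B. total_variation (local_sets B) V (Config B \<times> D) < \<infinity>)}"

definition positive_part ::
    "'a::euclidean_space set \<Rightarrow> (('a measure \<times> 'a) set \<Rightarrow> real) \<Rightarrow> ('a measure \<times> 'a) measure" where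
  "positive_part B V = measure_of (space (field_algebra B)) (sets (field_algebra B))
     (upper_variation (local_sets B) V)"

definition negative_part ::
    "'a::euclidean_space set \<Rightarrow> (('a measure \<times> 'a) set \<Rightarrow> real) \<Rightarrow> ('a measure \<times> 'a) measure" where
  "negative_part B V = measure_of (space (field_algebra B)) (sets (field_algebra B))
     (lower_variation (local_sets B) V)"

definition field_integral ::
    "'a::euclidean_space set \<Rightarrow> (('a measure \<times> 'a) set \<Rightarrow> real) \<Rightarrow> ('a measure \<times> 'a \<Rightarrow> real) \<Rightarrow> real"
  where
  "field_integral B V g = (\<integral>p. g p \<partial>positive_part B V) - (\<integral>p. g p \<partial>negative_part B V)"

definition Ms :: "(('a::euclidean_space measure \<times> 'a) set \<Rightarrow> real) set" where
  "Ms = {V \<in> Mb0 UNIV. \<forall>z. \<forall>A\<in>local_sets UNIV.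
           V {(\<xi>, x). \<xi> \<in> Config UNIV \<and> (shift z \<xi>, x - z) \<in> A} = V A}"


section \<open>The continuity equation\<close>

definition add_point :: "'a measure \<Rightarrow> 'a \<Rightarrow> 'a measure" where
  "add_point \<xi> z = measure_of (space \<xi>) (sets \<xi>) (\<lambda>A. emeasure \<xi> A + indicator A z)"

text \<open>If \<open>\<xi>\<close> already has a point at \<open>z\<close> then \<^term>\<open>add_point \<xi> z\<close> is not simple; \<open>F\<close> is therefore
  evaluated outside \<^term>\<open>Config B\<close> there, which makes sense for the functionals used below.\<close>

definition diff_op :: "'a \<Rightarrow> ('a measure \<Rightarrow> real) \<Rightarrow> 'a measure \<Rightarrow> real" where
  "diff_op z F \<xi> = F (add_point \<xi> z) - F \<xi>"

definition laplace :: "('a \<Rightarrow> real) \<Rightarrow> 'a measure \<Rightarrow> real" where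
  "laplace f \<xi> = exp (- (\<integral>x. f x \<partial>\<xi>))"

text \<open>The integrability and measurability clauses state that the time integrals are well defined
  (the Isabelle integral is a total function). Curves are functions of a real parameter, of which
  only the restriction to \<open>[0,1]\<close> matters.\<close>

definition CE ::
    "'a::euclidean_space set \<Rightarrow> 'a measure measure \<Rightarrow> 'a measure measure \<Rightarrow>
      ((real \<Rightarrow> 'a measure measure) \<times> (real \<Rightarrow> ('a measure \<times> 'a) set \<Rightarrow> real)) set" where
  "CE B P0 P1' = {(P, V).
     (\<forall>t\<in>{0..1}. P t \<in> P1 B \<and> V t \<in> Mb0 B) \<and>
     P 0 = P0 \<and> P 1 = P1' \<and>
     continuous_map (top_of_set {0..1}) (P1_topology B) P \<and>
     (\<forall>\<phi>\<in>Cc_smooth_01. \<forall>f\<in>Cc B. (\<forall>x\<in>B. 0 \<le> f x) \<longrightarrow>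
        set_integrable lborel {0..1} (\<lambda>t. deriv \<phi> t * (\<integral>\<xi>. laplace f \<xi> \<partial>P t)) \<and>
        set_integrable lborel {0..1}
          (\<lambda>t. \<phi> t * field_integral B (V t) (\<lambda>(\<xi>, z). diff_op z (laplace f) \<xi>)) \<and>
        (LBINT t:{0..1}. deriv \<phi> t * (\<integral>\<xi>. laplace f \<xi> \<partial>P t)) +
        (LBINT t:{0..1}. \<phi> t * field_integral B (V t) (\<lambda>(\<xi>, z). diff_op z (laplace f) \<xi>)) = 0) \<and>
     (\<forall>D\<in>bounded_borel B.
        (\<lambda>t. total_variation (local_sets B) (V t) (Config B \<times> D))
          \<in> borel_measurable (restrict_space lborel {0..1}) \<and>
        (\<integral>\<^sup>+t\<in>{0..1}. total_variation (local_sets B) (V t) (Config B \<times> D) \<partial>lborel) < \<infinity>)}"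

definition CEs ::
    "'a::euclidean_space measure measure \<Rightarrow> 'a measure measure \<Rightarrow>
      ((real \<Rightarrow> 'a measure measure) \<times> (real \<Rightarrow> ('a measure \<times> 'a) set \<Rightarrow> real)) set" where
  "CEs P0 P1' = {(P, V) \<in> CE UNIV P0 P1'. \<forall>t\<in>{0..1}. V t \<in> Ms}"

end

theory Submission
  imports Defs
begin

text \<open>The two laws are joined through the law \<open>E\<close> of the empty configuration: the curve is affine from
  \<open>\<^bold>P\<^sub>0\<close> to \<open>E\<close> and then from \<open>E\<close> to \<open>\<^bold>P\<^sub>1\<close>. On an affine piece between \<open>E\<close> and \<open>\<^bold>P\<close> the field has to
  satisfy \<open>\<integral> D\<^sub>z e\<^bsup>-\<xi>(f)\<^esup> d\<^bold>V = \<integral> e\<^bsup>-\<xi>(f)\<^esup> d\<^bold>P - 1\<close>. Such a field arises by building each configuration \<open>\<xi>\<close>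
  point by point in the lexicographic order: let \<open>\<^bold>V\<close> be the image of \<open>\<xi>(dx) \<^bold>P(d\<xi>)\<close> under
  \<open>(\<xi>, x) \<mapsto> (\<xi> restricted to {y. y < x}, x)\<close>; the increments of \<open>e\<^bsup>-\<xi>(f)\<^esup>\<close> telescope. The order is
  invariant under translations, so \<open>\<^bold>V\<close> is stationary if \<open>\<^bold>P\<close> is.\<close>


section \<open>Linear combinations of measures\<close>

text \<open>Passing through \<open>E\<close> keeps the field at each time a real multiple of one
  positive measure, so its variations are explicit; on a direct segment it would be a difference of
  two fluxes, whose Jordan decomposition would have to be found. A configuration may be infinite and
  have no first point, so building it point by point is no enumeration. It makes sense because test
  functions have compact support: atoms at which \<open>f\<close> vanishes add nothing to the sum
  and leave the exponential unchanged, so that the telescoping runs over finitely many atoms. The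
  main obstacle is measurability. The sigma-algebra on configurations is generated by vaguely open
  sets, that is, by test functions, and a Polish set need not be locally compact. Points of
  \<open>B\<close> without a compact neighbourhood are invisible to test functions, so the field is
  formed over the remaining points only; the equation loses nothing, since test functions vanish at
  the others. For the map that cuts off the future to be measurable, vaguely open sets are first
  written as countable unions of events that count atoms.\<close>

definition lincomb :: "ennreal \<Rightarrow> ennreal \<Rightarrow> 'a measure \<Rightarrow> 'a measure \<Rightarrow> 'a measure" where
  "lincomb a b M N = measure_of (space M) (sets M) (\<lambda>A. a * emeasure M A + b * emeasure N A)"

lemma sets_lincomb [simp, measurable_cong]: "sets (lincomb a b M N) = sets M"
  and space_lincomb [simp]: "space (lincomb a b M N) = space M"
  by (simp_all add: lincomb_def)

text \<open>Countable additivity passes to weighted sums because series in \<open>ennreal\<close>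
  add without convergence conditions. The construction serves for mixtures of laws, for adding a
  point to a configuration and for rescaling a flux.\<close>

lemma emeasure_lincomb:
  assumes "sets N = sets M" "A \<in> sets M"
  shows "emeasure (lincomb a b M N) A = a * emeasure M A + b * emeasure N A"
  unfolding lincomb_def
proof (rule emeasure_measure_of_sigma)
  show "sigma_algebra (space M) (sets M)"
    by (rule sets.sigma_algebra_axioms)
  show "positive (sets M) (\<lambda>A. a * emeasure M A + b * emeasure N A)"
    by (simp add: positive_def)
  show "countably_additive (sets M) (\<lambda>A. a * emeasure M A + b * emeasure N A)"
  proof (rule countably_additiveI)
    fix A :: "nat \<Rightarrow> _"
    assume "range A \<subseteq> sets M" "disjoint_family A"
    then show "(\<Sum>i. a * emeasure M (A i) + b * emeasure N (A i)) =
        a * emeasure M (\<Union>i. A i) + b * emeasure N (\<Union>i. A i)"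
      using assms(1) by (simp add: suminf_add[symmetric] suminf_emeasure)
  qed
qed (rule assms)

lemma nn_integral_lincomb:
  assumes S: "sets N = sets M" and f: "f \<in> borel_measurable M"
  shows "(\<integral>\<^sup>+x. f x \<partial>lincomb a b M N) = a * (\<integral>\<^sup>+x. f x \<partial>M) + b * (\<integral>\<^sup>+x. f x \<partial>N)"
  using f
proof (induction rule: borel_measurable_induct)
  case (cong f g)
  have "space N = space M"
    using S by (rule sets_eq_imp_space_eq)
  with cong have "integral\<^sup>N K f = integral\<^sup>N K g" if "K \<in> {M, N, lincomb a b M N}" for K
    using that by (intro nn_integral_cong) auto
  with cong show ?case
    by simp
next
  case (set A)
  then show ?case
    using S by (simp add: emeasure_lincomb)
next
  case (mult u c)
  have "u \<in> borel_measurable N"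
    using mult S by (simp cong: measurable_cong_sets)
  with mult show ?case
    by (simp add: nn_integral_cmult algebra_simps)
next
  case (add u v)
  have "u \<in> borel_measurable N" "v \<in> borel_measurable N"
    using add S by (simp_all cong: measurable_cong_sets)
  with add show ?case
    by (simp add: nn_integral_add algebra_simps)
next
  case (seq U)
  have N: "U i \<in> borel_measurable N" for i
    using seq S by (simp cong: measurable_cong_sets)
  have "incseq (\<lambda>i. \<integral>\<^sup>+x. U i x \<partial>M)" "incseq (\<lambda>i. \<integral>\<^sup>+x. U i x \<partial>N)"
    using \<open>incseq U\<close> by (auto simp: incseq_def le_fun_def intro!: nn_integral_mono)
  then have "(SUP i. a * (\<integral>\<^sup>+x. U i x \<partial>M) + b * (\<integral>\<^sup>+x. U i x \<partial>N)) =
      a * (SUP i. \<integral>\<^sup>+x. U i x \<partial>M) + b * (SUP i. \<integral>\<^sup>+x. U i x \<partial>N)"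
    by (subst ennreal_SUP_add)
      (auto simp: SUP_mult_left_ennreal incseq_def intro!: mult_left_mono)
  then show ?case
    using seq N by (simp add: nn_integral_monotone_convergence_SUP image_comp SUP_apply)
qed

text \<open>Stated for arbitrary \<open>f\<close> because, if \<open>B\<close> is not locally compact, the map \<open>\<xi> \<mapsto> \<xi> D\<close> need not be
  measurable for the Borel algebra of the vague topology.\<close>

lemma nn_integral_lincomb_le:
  assumes S: "sets N = sets M"
  shows "(\<integral>\<^sup>+x. f x \<partial>lincomb a b M N) \<le> a * (\<integral>\<^sup>+x. f x \<partial>M) + b * (\<integral>\<^sup>+x. f x \<partial>N)"
  unfolding nn_integral_def[of "lincomb a b M N"]
proof (rule SUP_least)
  fix g assume "g \<in> {g. simple_function (lincomb a b M N) g \<and> g \<le> f}"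
  then have g: "simple_function (lincomb a b M N) g" and le: "g \<le> f"
    by auto
  have "g \<in> borel_measurable M"
    using borel_measurable_simple_function[OF g] by (simp cong: measurable_cong_sets)
  then have "integral\<^sup>S (lincomb a b M N) g = a * (\<integral>\<^sup>+x. g x \<partial>M) + b * (\<integral>\<^sup>+x. g x \<partial>N)"
    using nn_integral_lincomb[OF S] nn_integral_eq_simple_integral[OF g] by simp
  also have "\<dots> \<le> a * (\<integral>\<^sup>+x. f x \<partial>M) + b * (\<integral>\<^sup>+x. f x \<partial>N)"
    using le by (intro add_mono mult_left_mono nn_integral_mono) (auto simp: le_fun_def)
  finally show "integral\<^sup>S (lincomb a b M N) g \<le> a * (\<integral>\<^sup>+x. f x \<partial>M) + b * (\<integral>\<^sup>+x. f x \<partial>N)" .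
qed

lemma integrable_lincomb:
  fixes f :: "'a \<Rightarrow> real"
  assumes S: "sets N = sets M" and "a < \<infinity>" "b < \<infinity>"
    and f: "integrable M f" "integrable N f"
  shows "integrable (lincomb a b M N) f"
    and "(\<integral>x. f x \<partial>lincomb a b M N) = enn2real a * (\<integral>x. f x \<partial>M) + enn2real b * (\<integral>x. f x \<partial>N)"
proof -
  obtain a' b' where ab: "a = ennreal a'" "b = ennreal b'" "0 \<le> a'" "0 \<le> b'"
    using assms(2,3) by (metis ennreal_cases infinity_ennreal_def less_irrefl)
  have [measurable]: "f \<in> borel_measurable M"
    using f by simp
  have fin: "(\<integral>\<^sup>+x. ennreal (g x) \<partial>K) < \<infinity>" if "integrable K f" "\<And>x. g x \<le> \<bar>f x\<bar>" for K g
  proof -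
    have "(\<integral>\<^sup>+x. ennreal (g x) \<partial>K) \<le> (\<integral>\<^sup>+x. ennreal (norm (f x)) \<partial>K)"
      using that by (intro nn_integral_mono ennreal_leI) auto
    also have "\<dots> < \<infinity>"
      using that by (simp add: integrable_iff_bounded)
    finally show ?thesis .
  qed
  note I = fin[OF f(1), of "\<lambda>x. f x"] fin[OF f(1), of "\<lambda>x. - f x"]
    fin[OF f(2), of "\<lambda>x. f x"] fin[OF f(2), of "\<lambda>x. - f x"] fin[OF f(1), of "\<lambda>x. \<bar>f x\<bar>"]
    fin[OF f(2), of "\<lambda>x. \<bar>f x\<bar>"]
  show int: "integrable (lincomb a b M N) f"
  proof (rule integrableI_bounded)
    show "f \<in> borel_measurable (lincomb a b M N)"
      by simp
    show "(\<integral>\<^sup>+x. ennreal (norm (f x)) \<partial>lincomb a b M N) < \<infinity>"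
      using I ab by (subst nn_integral_lincomb[OF S]) (auto simp: ennreal_mult_less_top)
  qed
  \<comment> \<open>\<open>enn2real\<close> is additive only on finite values, so finiteness comes
    first. Allowing any \<open>g\<close> below the modulus of \<open>f\<close> covers the positive
    and the negative part at once.\<close>
  have e: "enn2real (a * (\<integral>\<^sup>+x. ennreal (g x) \<partial>M) + b * (\<integral>\<^sup>+x. ennreal (g x) \<partial>N)) =
     a' * enn2real (\<integral>\<^sup>+x. ennreal (g x) \<partial>M) + b' * enn2real (\<integral>\<^sup>+x. ennreal (g x) \<partial>N)"
    if "\<And>x. g x \<le> \<bar>f x\<bar>" for g
    using fin[OF f(1), of g] fin[OF f(2), of g] that ab
    by (subst enn2real_plus) (auto simp: ennreal_mult_less_top enn2real_mult)
  show "(\<integral>x. f x \<partial>lincomb a b M N) = enn2real a * (\<integral>x. f x \<partial>M) + enn2real b * (\<integral>x. f x \<partial>N)"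
    unfolding real_lebesgue_integral_def[OF int] real_lebesgue_integral_def[OF f(1)]
      real_lebesgue_integral_def[OF f(2)]
    by (subst (1 2) nn_integral_lincomb[OF S]; (measurable)?)
      (use e[of f] e[of "\<lambda>x. - f x"] ab in \<open>simp add: algebra_simps\<close>)
qed


section \<open>The lexicographic order\<close>

text \<open>\<open>Basis\<close> is an unordered finite set; fixing an enumeration gives the
  coordinates an order of priority.\<close>

definition basis_enum :: "nat \<Rightarrow> 'a::euclidean_space" where
  "basis_enum = (SOME b. bij_betw b {..<DIM('a)} Basis)"

lemma basis_enum: "bij_betw basis_enum {..<DIM('a)} (Basis :: 'a::euclidean_space set)"
proof -
  have "\<exists>b. bij_betw b {..<DIM('a)} (Basis :: 'a set)"
    using ex_bij_betw_nat_finite[of "Basis :: 'a set"] by (simp add: atLeast0LessThan)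
  then show ?thesis
    unfolding basis_enum_def by (rule someI_ex)
qed

text \<open>Besides being a strict total order, the relation has two properties on which the
  construction rests: translation invariance, which carries stationarity from the law to the field,
  and joint Borel measurability, which makes the field a measure.\<close>

definition lexless :: "'a::euclidean_space \<Rightarrow> 'a \<Rightarrow> bool" where
  "lexless x y \<longleftrightarrow> (\<exists>i<DIM('a). x \<bullet> basis_enum i < y \<bullet> basis_enum i \<and>
      (\<forall>j<i. x \<bullet> basis_enum j = y \<bullet> basis_enum j))"

lemma lexless_irrefl [simp]: "\<not> lexless x x"
  by (simp add: lexless_def)

lemma lexless_trans: "lexless x y \<Longrightarrow> lexless y z \<Longrightarrow> lexless x z"
  unfolding lexless_def
proof (elim exE conjE)
  fix i k
  assume *: "i < DIM('a)" "x \<bullet> basis_enum i < y \<bullet> basis_enum i"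
    "\<forall>j<i. x \<bullet> basis_enum j = y \<bullet> basis_enum j"
    "k < DIM('a)" "y \<bullet> basis_enum k < z \<bullet> basis_enum k"
    "\<forall>j<k. y \<bullet> basis_enum j = z \<bullet> basis_enum j"
  consider "i < k" | "i = k" | "k < i" by linarith
  then show "\<exists>i<DIM('a). x \<bullet> basis_enum i < z \<bullet> basis_enum i \<and>
      (\<forall>j<i. x \<bullet> basis_enum j = z \<bullet> basis_enum j)"
  proof cases
    case 1
    then show ?thesis using * by (intro exI[of _ i]) auto
  next
    case 2
    then show ?thesis using * by (intro exI[of _ i]) auto
  next
    case 3
    then show ?thesis using * by (intro exI[of _ k]) auto
  qed
qed

lemma lexless_total:
  fixes x y :: "'a::euclidean_space"
  assumes "x \<noteq> y"
  shows "lexless x y \<or> lexless y x"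
proof -
  let ?P = "\<lambda>i. i < DIM('a) \<and> x \<bullet> basis_enum i \<noteq> y \<bullet> basis_enum i"
  obtain b :: 'a where b: "b \<in> Basis" "x \<bullet> b \<noteq> y \<bullet> b"
    using assms by (auto simp: euclidean_eq_iff[of x y])
  have "b \<in> basis_enum ` {..<DIM('a)}"
    using b(1) basis_enum[where 'a = 'a] by (simp add: bij_betw_def)
  then obtain k where "?P k"
    using b(2) by blast
  define i where "i = (LEAST i. ?P i)"
  have i: "?P i"
    unfolding i_def by (rule LeastI) fact
  have j: "\<forall>j<i. x \<bullet> basis_enum j = y \<bullet> basis_enum j"
  proof (intro allI impI)
    fix j assume "j < i"
    then have "\<not> ?P j" "j < DIM('a)"
      using i not_less_Least[of j ?P] unfolding i_def by (blast, linarith)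
    then show "x \<bullet> basis_enum j = y \<bullet> basis_enum j"
      by blast
  qed
  from i have "x \<bullet> basis_enum i < y \<bullet> basis_enum i \<or> y \<bullet> basis_enum i < x \<bullet> basis_enum i"
    by auto
  then show ?thesis
  proof
    assume "x \<bullet> basis_enum i < y \<bullet> basis_enum i"
    then have "lexless x y"
      unfolding lexless_def using i j by blast
    then show ?thesis ..
  next
    assume "y \<bullet> basis_enum i < x \<bullet> basis_enum i"
    then have "lexless y x"
      unfolding lexless_def using i j by metis
    then show ?thesis ..
  qed
qed

lemma lexless_diff [simp]: "lexless (x - z) (y - z) \<longleftrightarrow> lexless x y"
  by (simp add: lexless_def inner_diff_left)

lemma lexless_measurable [measurable]:
  assumes [measurable]: "f \<in> borel_measurable M" "g \<in> borel_measurable M"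
  shows "Measurable.pred M (\<lambda>w. lexless (f w) (g w))"
  unfolding lexless_def by measurable


section \<open>Configurations as sets of atoms\<close>

lemma space_restrict_borel [simp]: "space (restrict_space borel B) = B"
  by (simp add: space_restrict_space)

lemma Config_sets: "\<xi> \<in> Config B \<Longrightarrow> sets \<xi> = sets (restrict_space borel B)"
  by (simp add: Config_def)

lemma Config_space: "\<xi> \<in> Config B \<Longrightarrow> space \<xi> = B"
  by (simp add: sets_eq_imp_space_eq[OF Config_sets])

lemma Config_Nats: "\<xi> \<in> Config B \<Longrightarrow> D \<in> bounded_borel B \<Longrightarrow> emeasure \<xi> D \<in> \<nat>"
  by (simp add: Config_def)

lemma Config_finite:
  assumes "\<xi> \<in> Config B" "D \<in> bounded_borel B"
  shows "emeasure \<xi> D < \<infinity>"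
  using Config_Nats[OF assms] by (auto simp: Nats_def of_nat_less_top)

lemma Nats_ennreal_less_1: "v \<in> \<nat> \<Longrightarrow> v < (1 :: ennreal) \<Longrightarrow> v = 0"
  by (auto simp: Nats_def)

lemma bounded_borel_subset:
  "D \<in> bounded_borel B \<Longrightarrow> A \<in> sets (restrict_space borel B) \<Longrightarrow> A \<subseteq> D \<Longrightarrow> A \<in> bounded_borel B"
  unfolding bounded_borel_def by (auto intro: bounded_subset)

lemma singleton_bounded_borel: "x \<in> B \<Longrightarrow> {x} \<in> bounded_borel B"
  by (auto simp: bounded_borel_def sets_restrict_space image_iff intro!: bexI[of _ "{x}"])

lemma ball_bounded_borel: "B \<inter> ball x r \<in> bounded_borel B"
  by (auto simp: bounded_borel_def sets_restrict_space intro: bounded_subset[OF bounded_ball])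

definition atoms :: "'a measure \<Rightarrow> 'a set" where
  "atoms \<xi> = {x \<in> space \<xi>. emeasure \<xi> {x} \<noteq> 0}"

lemma emeasure_atom:
  assumes "\<xi> \<in> Config B" "x \<in> atoms \<xi>"
  shows "emeasure \<xi> {x} = 1"
proof -
  have "x \<in> B"
    using assms by (simp add: atoms_def Config_space)
  then have "emeasure \<xi> {x} \<le> 1" "\<not> emeasure \<xi> {x} < 1"
    using assms Nats_ennreal_less_1[OF Config_Nats[OF assms(1) singleton_bounded_borel]]
    by (auto simp: Config_def atoms_def)
  then show ?thesis
    by simp
qed

lemma finite_sets_restrict_borel:
  "finite A \<Longrightarrow> A \<subseteq> B \<Longrightarrow> A \<in> sets (restrict_space (borel :: 'a::t1_space measure) B)"
  by (auto simp: sets_restrict_space image_iff intro!: bexI[of _ A] borel_closed finite_imp_closed)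

lemma emeasure_finite_atoms:
  assumes \<xi>: "\<xi> \<in> Config B" and A: "finite A" "A \<subseteq> atoms \<xi>"
  shows "emeasure \<xi> A = of_nat (card A)"
proof -
  have "A \<subseteq> B"
    using A \<xi> by (auto simp: atoms_def Config_space)
  then have "emeasure \<xi> A = (\<Sum>x\<in>A. emeasure \<xi> {x})"
    using A \<xi> by (intro emeasure_eq_sum_singleton) (auto simp: Config_sets intro!: finite_sets_restrict_borel)
  also have "\<dots> = (\<Sum>x\<in>A. 1)"
    using A by (intro sum.cong refl emeasure_atom[OF \<xi>]) auto
  finally show ?thesis
    by simp
qed

text \<open>Atoms have mass exactly one, so \<open>n + 1\<close> of them do not fit into a set of
  mass \<open>n\<close>.\<close>

lemma finite_atoms:
  assumes \<xi>: "\<xi> \<in> Config B" and D: "D \<in> bounded_borel B"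
  shows "finite (atoms \<xi> \<inter> D)"
proof (rule ccontr)
  assume inf: "infinite (atoms \<xi> \<inter> D)"
  obtain n where n: "emeasure \<xi> D = of_nat n"
    using Config_Nats[OF \<xi> D] by (auto simp: Nats_def)
  obtain A where A: "A \<subseteq> atoms \<xi> \<inter> D" "finite A" "card A = Suc n"
    using infinite_arbitrarily_large[OF inf] by metis
  have "of_nat (Suc n) = emeasure \<xi> A"
    using A emeasure_finite_atoms[OF \<xi>, of A] by simp
  also have "\<dots> \<le> emeasure \<xi> D"
    using A D \<xi> by (intro emeasure_mono) (auto simp: Config_sets bounded_borel_def)
  finally show False
    by (simp add: n del: of_nat_Suc)
qed

lemma atoms_Int_sets:
  assumes \<xi>: "\<xi> \<in> Config B" and D: "D \<in> bounded_borel B"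
  shows "atoms \<xi> \<inter> D \<in> sets (restrict_space borel B)"
  using finite_atoms[OF assms] \<xi>
  by (intro finite_sets_restrict_borel) (auto simp: atoms_def Config_space)

text \<open>Around a point that is not an atom the mass of small balls tends to \<open>0\<close>, hence vanishes as it
  is an integer; the complement of the atoms is then covered by countably many null sets.\<close>

lemma Diff_atoms_null:
  assumes \<xi>: "\<xi> \<in> Config B" and D: "D \<in> bounded_borel B"
  shows "D - atoms \<xi> \<in> null_sets \<xi>"
proof -
  define E where "E = D - atoms \<xi>"
  have Es: "E \<in> sets (restrict_space borel B)"
    using atoms_Int_sets[OF assms] D sets.Diff[of D "restrict_space borel B" "atoms \<xi> \<inter> D"]
    by (simp add: E_def bounded_borel_def Diff_Int2 Int_commute Diff_Int)
  have "E \<subseteq> B"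
    using sets.sets_into_space[OF Es] by simp
  have EB: "E \<inter> ball x r \<in> sets (restrict_space borel B)" for x r
  proof -
    have "E \<inter> ball x r = E \<inter> (B \<inter> ball x r)"
      using \<open>E \<subseteq> B\<close> by auto
    also have "\<dots> \<in> sets (restrict_space borel B)"
      using ball_bounded_borel[of B x r] by (intro sets.Int[OF Es]) (simp add: bounded_borel_def)
    finally show ?thesis .
  qed
  have Eb: "E \<inter> ball x r \<in> bounded_borel B" for x r
    by (rule bounded_borel_subset[OF D EB]) (auto simp: E_def)
  have "\<exists>r>0. emeasure \<xi> (E \<inter> ball x r) = 0" if x: "x \<in> E" for x
  proof -
    define T where "T n = E \<inter> ball x (1 / Suc n)" for n
    have "(\<lambda>n. emeasure \<xi> (T n)) \<longlonglongrightarrow> emeasure \<xi> (\<Inter>n. T n)"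
    proof (rule Lim_emeasure_decseq)
      show "range T \<subseteq> sets \<xi>"
        using EB \<xi> by (auto simp: T_def Config_sets)
      show "decseq T"
        unfolding T_def decseq_def by (intro allI impI Int_mono order_refl subset_ball frac_le) auto
      show "emeasure \<xi> (T n) \<noteq> \<infinity>" for n
        using Config_finite[OF \<xi> Eb[of x "1 / Suc n"]] by (simp add: T_def)
    qed
    moreover have "(\<Inter>n. T n) = {x}"
    proof -
      have "y = x" if "\<And>n. y \<in> T n" for y
      proof (rule ccontr)
        assume "y \<noteq> x"
        then obtain n where "inverse (real (Suc n)) < dist x y"
          using reals_Archimedean[of "dist x y"] by auto
        then show False
          using that[of n] by (simp add: T_def inverse_eq_divide)
      qed
      then show ?thesis
        using x by (auto simp: T_def)
    qed
    moreover have "emeasure \<xi> {x} = 0"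
      using x \<open>E \<subseteq> B\<close> \<xi> by (auto simp: E_def atoms_def Config_space)
    ultimately have "(\<lambda>n. emeasure \<xi> (T n)) \<longlonglongrightarrow> 0"
      by simp
    then have "eventually (\<lambda>n. emeasure \<xi> (T n) < 1) sequentially"
      by (rule order_tendstoD) simp
    then obtain n where "emeasure \<xi> (T n) < 1"
      by (auto simp: eventually_sequentially)
    then have "emeasure \<xi> (T n) = 0"
      using Config_Nats[OF \<xi> Eb[of x "1 / Suc n"]] by (intro Nats_ennreal_less_1) (simp_all add: T_def)
    then show ?thesis
      by (intro exI[of _ "1 / Suc n"]) (simp add: T_def)
  qed
  then obtain r where r: "\<And>x. x \<in> E \<Longrightarrow> r x > 0 \<and> emeasure \<xi> (E \<inter> ball x (r x)) = 0"
    by metis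
  obtain F where F: "F \<subseteq> (\<lambda>x. ball x (r x)) ` E" "countable F" "\<Union>F = (\<Union>x\<in>E. ball x (r x))"
    by (rule Lindelof[of "(\<lambda>x. ball x (r x)) ` E"]) auto
  have "E = (\<Union>U\<in>F. E \<inter> U)"
    using F(3) r by auto
  moreover have "(\<Union>U\<in>F. E \<inter> U) \<in> null_sets \<xi>"
    using F(1,2) r EB \<xi> by (intro null_sets_UN') (auto simp: null_sets_def Config_sets)
  ultimately show ?thesis
    by (simp add: E_def)
qed

text \<open>Since \<open>D\<close> without the atoms is a null set and each atom has mass one,
  \<open>h\<close> agrees almost everywhere with a finite combination of indicators of points. This
  turns integrals against a configuration into finite sums.\<close>

lemma nn_integral_Config:
  assumes \<xi>: "\<xi> \<in> Config B" and D: "D \<in> bounded_borel B"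
    and h: "h \<in> borel_measurable (restrict_space borel B)" "\<And>x. x \<in> B - D \<Longrightarrow> h x = 0"
  shows "(\<integral>\<^sup>+x. h x \<partial>\<xi>) = (\<Sum>x\<in>atoms \<xi> \<inter> D. h x)"
proof -
  have fin: "finite (atoms \<xi> \<inter> D)"
    by (rule finite_atoms[OF \<xi> D])
  have s: "{a} \<in> sets \<xi>" if "a \<in> atoms \<xi> \<inter> D" for a
    using that \<xi> singleton_bounded_borel[of a B]
    by (auto simp: atoms_def Config_space Config_sets bounded_borel_def)
  have "AE x in \<xi>. x \<notin> D - atoms \<xi> \<and> x \<in> B"
    using AE_not_in[OF Diff_atoms_null[OF \<xi> D]] AE_space[of \<xi>] \<xi> by (auto simp: Config_space)
  then have "(\<integral>\<^sup>+x. h x \<partial>\<xi>) = (\<integral>\<^sup>+x. (\<Sum>a\<in>atoms \<xi> \<inter> D. h a * indicator {a} x) \<partial>\<xi>)"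
  proof (intro nn_integral_cong_AE, eventually_elim)
    case (elim x)
    show ?case
    proof (cases "x \<in> atoms \<xi> \<inter> D")
      case True
      then have "(\<Sum>a\<in>atoms \<xi> \<inter> D. h a * indicator {a} x) = (\<Sum>a\<in>{x}. h a * indicator {a} x)"
        using fin by (intro sum.mono_neutral_right) (auto simp: indicator_def)
      then show ?thesis
        by simp
    next
      case False
      then have "(\<Sum>a\<in>atoms \<xi> \<inter> D. h a * indicator {a} x) = 0"
        by (intro sum.neutral) (auto simp: indicator_def)
      moreover have "x \<notin> D"
        using elim False by auto
      ultimately show ?thesis
        using h(2)[of x] elim by simp
    qed
  qed
  also have "\<dots> = (\<Sum>a\<in>atoms \<xi> \<inter> D. \<integral>\<^sup>+x. h a * indicator {a} x \<partial>\<xi>)"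
    using s by (intro nn_integral_sum) auto
  also have "\<dots> = (\<Sum>a\<in>atoms \<xi> \<inter> D. h a * emeasure \<xi> {a})"
    using s by (intro sum.cong refl nn_integral_cmult_indicator) auto
  also have "\<dots> = (\<Sum>a\<in>atoms \<xi> \<inter> D. h a)"
    using emeasure_atom[OF \<xi>] by (intro sum.cong) auto
  finally show ?thesis .
qed

lemma emeasure_Config:
  assumes \<xi>: "\<xi> \<in> Config B" and D: "D \<in> bounded_borel B"
  shows "emeasure \<xi> D = of_nat (card (atoms \<xi> \<inter> D))"
proof -
  have Ds: "D \<in> sets (restrict_space borel B)"
    using D by (simp add: bounded_borel_def)
  have "emeasure \<xi> D = (\<integral>\<^sup>+x. indicator D x \<partial>\<xi>)"
    using Ds \<xi> by (simp add: Config_sets)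
  also have "\<dots> = (\<Sum>x\<in>atoms \<xi> \<inter> D. indicator D x)"
    using Ds by (intro nn_integral_Config[OF \<xi> D]) auto
  finally show ?thesis
    by simp
qed


section \<open>Test functions\<close>

lemma Cc_measurable [measurable]: "f \<in> Cc B \<Longrightarrow> f \<in> borel_measurable (restrict_space borel B)"
  by (simp add: Cc_def borel_measurable_continuous_on_restrict)

lemma Cc_measurable_Config: "f \<in> Cc B \<Longrightarrow> \<xi> \<in> Config B \<Longrightarrow> f \<in> borel_measurable \<xi>"
  using Cc_measurable[of f B] Config_sets[of \<xi> B] by (simp cong: measurable_cong_sets)

lemma Cc_supp: "f \<in> Cc B \<Longrightarrow> {x \<in> B. f x \<noteq> 0} \<in> bounded_borel B"
proof -
  assume f: "f \<in> Cc B"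
  have "{x \<in> space (restrict_space borel B). f x \<noteq> 0} \<in> sets (restrict_space borel B)"
    using Cc_measurable[OF f] by measurable
  moreover have "bounded {x \<in> B. f x \<noteq> 0}"
    using f closure_subset[of "{x \<in> B. f x \<noteq> 0}"]
    by (intro bounded_subset[OF compact_imp_bounded, of "B \<inter> closure {x \<in> B. f x \<noteq> 0}"])
      (auto simp: Cc_def)
  ultimately show ?thesis
    by (simp add: bounded_borel_def)
qed

lemma Cc_bounded:
  assumes "f \<in> Cc B"
  obtains C where "C > 0" "\<And>x. x \<in> B \<Longrightarrow> \<bar>f x\<bar> \<le> C"
proof -
  let ?K = "B \<inter> closure {x \<in> B. f x \<noteq> 0}"
  have "compact (f ` ?K)"
    using assms by (intro compact_continuous_image) (auto simp: Cc_def intro: continuous_on_subset)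
  then obtain C where "C > 0" "\<forall>y\<in>f ` ?K. norm y \<le> C"
    using compact_imp_bounded[of "f ` ?K"] unfolding bounded_pos by blast
  then have C: "\<And>y. y \<in> f ` ?K \<Longrightarrow> \<bar>y\<bar> \<le> C" "C > 0"
    by auto
  have "\<bar>f x\<bar> \<le> C" if "x \<in> B" for x
    using that C closure_subset[of "{x \<in> B. f x \<noteq> 0}"] by (cases "f x = 0") auto
  with C(2) show thesis
    by (rule that)
qed

lemma Cc_integrable:
  assumes f: "f \<in> Cc B" and \<xi>: "\<xi> \<in> Config B"
  shows "integrable \<xi> f"
proof -
  obtain C where C: "C > 0" "\<And>x. x \<in> B \<Longrightarrow> \<bar>f x\<bar> \<le> C"
    using Cc_bounded[OF f] by blast
  show ?thesis
  proof (rule integrableI_bounded_set[where A = "{x \<in> B. f x \<noteq> 0}" and B = C])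
    show "{x \<in> B. f x \<noteq> 0} \<in> sets \<xi>"
      using Cc_supp[OF f] \<xi> by (simp add: Config_sets bounded_borel_def)
    show "emeasure \<xi> {x \<in> B. f x \<noteq> 0} < \<infinity>"
      by (rule Config_finite[OF \<xi> Cc_supp[OF f]])
  qed (use C \<xi> Cc_measurable_Config[OF f \<xi>] in \<open>auto simp: Config_space\<close>)
qed

text \<open>\<open>D\<close> is left free so that two configurations, or a configuration and its
  pasts, can be summed over one common bounded set.\<close>

lemma integral_Config:
  assumes f: "f \<in> Cc B" and \<xi>: "\<xi> \<in> Config B" and D: "D \<in> bounded_borel B"
    and z: "\<And>x. x \<in> B - D \<Longrightarrow> f x = 0"
  shows "(\<integral>x. f x \<partial>\<xi>) = (\<Sum>x\<in>atoms \<xi> \<inter> D. f x)"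
proof -
  have sum_enn: "enn2real (\<Sum>x\<in>atoms \<xi> \<inter> D. ennreal (g x)) = (\<Sum>x\<in>atoms \<xi> \<inter> D. max 0 (g x))" for g
  proof -
    have "(\<Sum>x\<in>atoms \<xi> \<inter> D. ennreal (g x)) = (\<Sum>x\<in>atoms \<xi> \<inter> D. ennreal (max 0 (g x)))"
      by (intro sum.cong) (auto simp: max_def ennreal_neg)
    also have "\<dots> = ennreal (\<Sum>x\<in>atoms \<xi> \<inter> D. max 0 (g x))"
      by (intro sum_ennreal) simp
    finally show ?thesis
      by (simp add: sum_nonneg)
  qed
  have "(\<integral>x. f x \<partial>\<xi>) = (\<Sum>x\<in>atoms \<xi> \<inter> D. max 0 (f x)) - (\<Sum>x\<in>atoms \<xi> \<inter> D. max 0 (- f x))"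
    unfolding real_lebesgue_integral_def[OF Cc_integrable[OF f \<xi>]]
    using f z by (subst (1 2) nn_integral_Config[OF \<xi> D]) (auto simp: sum_enn)
  also have "\<dots> = (\<Sum>x\<in>atoms \<xi> \<inter> D. f x)"
    by (auto simp: sum_subtractf[symmetric] intro!: sum.cong)
  finally show ?thesis .
qed


section \<open>The part of the base set that is seen by test functions\<close>

text \<open>The vague topology does not see the points of \<open>B\<close> without a compact neighbourhood in \<open>B\<close>, so
  mass and flux can only be measured on the rest.\<close>

definition lc_part :: "'a::euclidean_space set \<Rightarrow> 'a set" where
  "lc_part B = {x \<in> B. \<exists>r>0. compact (B \<inter> cball x r)}"

lemma lc_part_UNIV [simp]: "lc_part UNIV = UNIV"
  by (auto simp: lc_part_def intro: exI[of _ 1])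

lemma lc_part_subset: "lc_part B \<subseteq> B"
  by (auto simp: lc_part_def)

lemma CcI:
  assumes "continuous_on B f" "compact K" "K \<subseteq> B" "\<And>x. x \<in> B \<Longrightarrow> f x \<noteq> 0 \<Longrightarrow> x \<in> K"
  shows "f \<in> Cc B"
proof -
  have "closure {x \<in> B. f x \<noteq> 0} \<subseteq> K"
    using assms by (intro closure_minimal compact_imp_closed) auto
  then have "B \<inter> closure {x \<in> B. f x \<noteq> 0} = K \<inter> closure {x \<in> B. f x \<noteq> 0}"
    using assms(3) by auto
  then show ?thesis
    using assms(1,2) by (simp add: Cc_def compact_Int_closed)
qed

lemma Cc_mult:
  assumes "f \<in> Cc B" "continuous_on B h"
  shows "(\<lambda>x. f x * h x) \<in> Cc B"
  using assms closure_subset[of "{x \<in> B. f x \<noteq> 0}"]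
  by (intro CcI[where K = "B \<inter> closure {x \<in> B. f x \<noteq> 0}"])
    (auto simp: Cc_def intro!: continuous_intros)

text \<open>By continuity \<open>f\<close> is nonzero on \<open>B\<close> near \<open>x\<close>, so
  a small closed ball meets \<open>B\<close> inside the compact support of \<open>f\<close>.
  Restricting to \<open>lc_part B\<close> is therefore harmless for test functions.\<close>

lemma Cc_nonzero_lc_part:
  assumes f: "f \<in> Cc B" and x: "x \<in> B" "f x \<noteq> 0"
  shows "x \<in> lc_part B"
proof -
  let ?K = "B \<inter> closure {x \<in> B. f x \<noteq> 0}"
  have "continuous_on B f" "compact ?K"
    using f by (auto simp: Cc_def)
  then obtain d where d: "d > 0" "\<And>y. y \<in> B \<Longrightarrow> dist y x < d \<Longrightarrow> dist (f y) (f x) < \<bar>f x\<bar>"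
    using x unfolding continuous_on_iff by (meson zero_less_abs_iff)
  have "f y \<noteq> 0" if "y \<in> B" "dist y x < d" for y
    using d(2)[OF that] by (auto simp: dist_real_def)
  then have "B \<inter> cball x (d / 2) = ?K \<inter> cball x (d / 2)"
    using d(1) closure_subset[of "{x \<in> B. f x \<noteq> 0}"] by (force simp: dist_commute)
  also have "compact \<dots>"
    using \<open>compact ?K\<close> by (rule compact_Int_closed) simp
  finally show ?thesis
    using d(1) x(1) by (auto simp: lc_part_def intro: exI[of _ "d / 2"])
qed

text \<open>By Lindelof countably many balls with compact trace on \<open>B\<close> cover
  \<open>lc_part B\<close>. The sum of the tent functions of the first \<open>k\<close> balls is
  multiplied by \<open>k\<close>, so that any positive value eventually exceeds 1, and then cut off
  at 1.\<close>

lemma cutoffs: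
  obtains g :: "nat \<Rightarrow> 'a::euclidean_space \<Rightarrow> real" where
    "\<And>k. g k \<in> Cc B" "\<And>k x. 0 \<le> g k x" "\<And>x. incseq (\<lambda>k. g k x)"
    "\<And>x. x \<in> B \<Longrightarrow> (SUP k. ennreal (g k x)) = indicator (lc_part B) x"
proof (cases "lc_part B = {}")
  case True
  show ?thesis
    by (rule that[of "\<lambda>_ _. 0"]) (auto simp: True Cc_def)
next
  case False
  obtain r where r: "\<And>x. x \<in> lc_part B \<Longrightarrow> r x > 0 \<and> compact (B \<inter> cball x (r x))"
    using bchoice[of "lc_part B" "\<lambda>x r. r > 0 \<and> compact (B \<inter> cball x r)"]
    by (auto simp: lc_part_def)
  have "open U" if "U \<in> (\<lambda>x. ball x (r x)) ` lc_part B" for U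
    using that by auto
  then obtain F where F: "F \<subseteq> (\<lambda>x. ball x (r x)) ` lc_part B" "countable F"
    "\<Union>F = (\<Union>x\<in>lc_part B. ball x (r x))"
    by (rule Lindelof)
  obtain X where X: "X \<subseteq> lc_part B" "countable X" "F = (\<lambda>x. ball x (r x)) ` X"
    using countable_subset_image[of F "\<lambda>x. ball x (r x)" "lc_part B"] F(1,2) by auto
  have cov: "\<exists>x\<in>X. y \<in> ball x (r x)" if "y \<in> lc_part B" for y
  proof -
    have "y \<in> ball y (r y)"
      using r[OF that] by simp
    then have "y \<in> \<Union>F"
      using that F(3) by blast
    then show ?thesis
      using X(3) by blast
  qed
  then have "X \<noteq> {}"
    using False by auto
  define c where "c = from_nat_into X"
  have c: "range c = X"
    using \<open>X \<noteq> {}\<close> X(2) by (simp add: c_def range_from_nat_into)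
  then have rc: "r (c i) > 0" "compact (B \<inter> cball (c i) (r (c i)))" for i
    using X(1) r[of "c i"] by auto
  define s where "s k y = (\<Sum>i<k. max 0 (r (c i) - dist (c i) y))" for k :: nat and y
  have s0: "0 \<le> s k y" for k y
    by (auto simp: s_def intro: sum_nonneg)
  have spos: "s k y \<noteq> 0 \<longleftrightarrow> (\<exists>i<k. y \<in> ball (c i) (r (c i)))" for k y
    unfolding s_def by (subst sum_nonneg_eq_0_iff) (auto simp: max_def not_le intro: bexI[rotated])
  have smono: "s k y \<le> s l y" if "k \<le> l" for k l y
    unfolding s_def using that by (intro sum_mono2) auto
  define g where "g k y = min 1 (real k * s k y)" for k y
  have lim: "(\<lambda>k. g k x) \<longlonglongrightarrow> indicator (lc_part B) x" if x: "x \<in> B" for x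
  proof (cases "x \<in> lc_part B")
    case True
    then obtain i where i: "x \<in> ball (c i) (r (c i))"
      using cov c by auto
    define e where "e = s (Suc i) x"
    have "e > 0"
    proof -
      have "s (Suc i) x \<noteq> 0"
        unfolding spos using i by blast
      then show ?thesis
        using s0[of "Suc i" x] by (simp add: e_def)
    qed
    then obtain n where n: "inverse (real (Suc n)) < e"
      using reals_Archimedean by blast
    have "g k x = 1" if "k \<ge> max (Suc n) (Suc i)" for k
    proof -
      have "1 \<le> real (Suc n) * e"
        using n by (simp add: field_simps)
      also have "\<dots> \<le> real k * s k x"
        using that smono[of "Suc i" k x] s0 \<open>e > 0\<close> by (intro mult_mono) (auto simp: e_def)
      finally show ?thesis
        by (simp add: g_def)
    qed
    then have "eventually (\<lambda>k. g k x = 1) sequentially"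
      by (auto simp: eventually_sequentially)
    then show ?thesis
      using True by (simp add: tendsto_eventually)
  next
    case False
    have "x \<notin> ball (c i) (r (c i))" for i
    proof
      assume xi: "x \<in> ball (c i) (r (c i))"
      \<comment> \<open>The distance left to the boundary of the ball: \<open>cball x t\<close>
        stays inside a closed ball with compact trace, which would put \<open>x\<close> into
        \<open>lc_part B\<close>.\<close>
      define t where "t = r (c i) - dist (c i) x"
      have "cball x t \<subseteq> cball (c i) (r (c i))"
        by (simp add: cball_subset_cball_iff t_def dist_commute)
      then have "B \<inter> cball x t = (B \<inter> cball (c i) (r (c i))) \<inter> cball x t"
        by auto
      then have "compact (B \<inter> cball x t)"
        using compact_Int_closed[OF rc(2)[of i], of "cball x t"] by simp
      then show False
        using False x xi by (auto simp: lc_part_def t_def)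
    qed
    then have "g k x = 0" for k
      using spos[of k x] by (auto simp: g_def)
    then show ?thesis
      using False by simp
  qed
  have inc: "incseq (\<lambda>k. g k x)" for x
    unfolding incseq_def g_def
    by (intro allI impI min.mono mult_mono smono s0 order_refl) auto
  show ?thesis
  proof (rule that[of g])
    show "g k \<in> Cc B" for k
    proof (rule CcI[where K = "\<Union>i<k. B \<inter> cball (c i) (r (c i))"])
      show "continuous_on B (g k)"
        unfolding g_def s_def by (intro continuous_intros)
      show "compact (\<Union>i<k. B \<inter> cball (c i) (r (c i)))"
        using rc by (intro compact_UN) auto
      show "x \<in> (\<Union>i<k. B \<inter> cball (c i) (r (c i)))" if "x \<in> B" "g k x \<noteq> 0" for x
      proof -
        have "s k x \<noteq> 0"
          using that by (auto simp: g_def)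
        then obtain i where "i < k" "x \<in> ball (c i) (r (c i))"
          using spos by blast
        then show ?thesis
          using that(1) ball_subset_cball by blast
      qed
    qed auto
    show "0 \<le> g k x" for k x
      using s0 by (simp add: g_def)
    show "incseq (\<lambda>k. g k x)" for x
      by (rule inc)
    show "(SUP k. ennreal (g k x)) = indicator (lc_part B) x" if "x \<in> B" for x
    proof -
      have "(\<lambda>k. ennreal (g k x)) \<longlonglongrightarrow> ennreal (indicator (lc_part B) x)"
        using lim[OF that] by (rule tendsto_ennrealI)
      moreover have "(\<lambda>k. ennreal (g k x)) \<longlonglongrightarrow> (SUP k. ennreal (g k x))"
        using inc[of x] by (intro LIMSEQ_SUP) (auto simp: incseq_def intro: ennreal_leI)
      ultimately have "(SUP k. ennreal (g k x)) = ennreal (indicator (lc_part B) x)"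
        using LIMSEQ_unique by blast
      then show ?thesis
        by (simp add: indicator_def)
    qed
  qed
qed

text \<open>It is the set on which the supremum of the countably many cutoffs equals 1.\<close>

lemma lc_part_sets [measurable]: "lc_part B \<in> sets (restrict_space borel B)"
proof -
  obtain g :: "nat \<Rightarrow> 'a \<Rightarrow> real" where g: "\<And>k. g k \<in> Cc B"
    "\<And>x. x \<in> B \<Longrightarrow> (SUP k. ennreal (g k x)) = indicator (lc_part B) x"
    using cutoffs[of B] by metis
  have [measurable]: "g k \<in> borel_measurable (restrict_space borel B)" for k
    by (rule Cc_measurable[OF g(1)])
  have "{x \<in> space (restrict_space borel B). (SUP k. ennreal (g k x)) = 1} \<in> sets (restrict_space borel B)"
    by measurable
  also have "{x \<in> space (restrict_space borel B). (SUP k. ennreal (g k x)) = 1} = lc_part B"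
    using lc_part_subset[of B] by (auto simp: g(2) indicator_def split: if_splits)
  finally show ?thesis .
qed


section \<open>Kernels into the space of configurations\<close>

text \<open>A random configuration, with measurability asked only where it can be checked directly,
  on integrals of test functions. Everything stronger is derived: first measurability of integrals
  over \<open>lc_part B\<close>, then measurability as a map into
  \<open>config_algebra B\<close>.\<close>

definition config_kernel :: "'w measure \<Rightarrow> 'a::euclidean_space set \<Rightarrow> ('w \<Rightarrow> 'a measure) \<Rightarrow> bool" where
  "config_kernel M B T \<longleftrightarrow> (\<forall>w\<in>space M. T w \<in> Config B) \<and>
     (\<forall>f\<in>Cc B. (\<lambda>w. \<integral>x. f x \<partial>T w) \<in> borel_measurable M)"

lemma config_kernelD:
  assumes "config_kernel M B T"
  shows "w \<in> space M \<Longrightarrow> T w \<in> Config B"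
    and "f \<in> Cc B \<Longrightarrow> (\<lambda>w. \<integral>x. f x \<partial>T w) \<in> borel_measurable M"
  using assms by (auto simp: config_kernel_def)

lemma kernel_section_measurable:
  assumes "config_kernel M B T" "w \<in> space M"
    "h \<in> borel_measurable (M \<Otimes>\<^sub>M restrict_space borel B)"
  shows "(\<lambda>x. h (w, x)) \<in> borel_measurable (T w)"
proof -
  have "(\<lambda>x. h (w, x)) \<in> borel_measurable (restrict_space borel B)"
    using assms(2,3) by measurable
  then show ?thesis
    using Config_sets[OF config_kernelD(1)[OF assms(1,2)]] by (simp cong: measurable_cong_sets)
qed

lemma kernel_measurable_Cc:
  assumes T: "config_kernel M B T" and f: "f \<in> Cc B" "\<And>x. 0 \<le> f x"
  shows "(\<lambda>w. \<integral>\<^sup>+x. ennreal (f x) \<partial>T w) \<in> borel_measurable M"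
proof -
  have "(\<lambda>w. ennreal (\<integral>x. f x \<partial>T w)) \<in> borel_measurable M"
    using config_kernelD(2)[OF T f(1)] by simp
  moreover have "(\<integral>\<^sup>+x. ennreal (f x) \<partial>T w) = ennreal (\<integral>x. f x \<partial>T w)" if "w \<in> space M" for w
    using Cc_integrable[OF f(1) config_kernelD(1)[OF T that]] f(2)
    by (intro nn_integral_eq_integral) auto
  ultimately show ?thesis
    by (simp cong: measurable_cong)
qed

lemma kernel_measurable_open:
  assumes T: "config_kernel M B T" and f: "f \<in> Cc B" "\<And>x. 0 \<le> f x" and U: "open U"
  shows "(\<lambda>w. \<integral>\<^sup>+x. indicator U x * ennreal (f x) \<partial>T w) \<in> borel_measurable M"
proof (cases "U = UNIV")
  case True
  then show ?thesis
    using kernel_measurable_Cc[OF T f] by simp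
next
  case False
  \<comment> \<open>\<open>infdist\<close> to the empty set is 0 by convention, so these functions
    would vanish identically for \<open>U = UNIV\<close>; hence the separate case.\<close>
  define h where "h n x = min 1 (real n * infdist x (- U))" for n :: nat and x
  have h0: "0 \<le> h n x" for n x
    by (simp add: h_def infdist_nonneg)
  have hm: "h n x \<le> h k x" if "n \<le> k" for n k x
    unfolding h_def using that by (intro min.mono mult_right_mono) (auto simp: infdist_nonneg)
  have lim: "(\<lambda>n. h n x) \<longlonglongrightarrow> indicator U x" for x
  proof (cases "x \<in> U")
    case True
    then have "infdist x (- U) > 0"
      using in_closed_iff_infdist_zero[of "- U" x] False U infdist_nonneg[of x "- U"]
      by (auto simp: less_le)
    then obtain n where n: "inverse (real (Suc n)) < infdist x (- U)"
      using reals_Archimedean by blast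
    have "h k x = 1" if "k \<ge> Suc n" for k
    proof -
      have "1 \<le> real (Suc n) * infdist x (- U)"
        using n by (simp add: field_simps)
      also have "\<dots> \<le> real k * infdist x (- U)"
        using that by (intro mult_right_mono) (auto simp: infdist_nonneg)
      finally show ?thesis
        by (simp add: h_def)
    qed
    then have "eventually (\<lambda>k. h k x = 1) sequentially"
      by (auto simp: eventually_sequentially)
    then show ?thesis
      using True by (simp add: tendsto_eventually)
  next
    case False
    then show ?thesis
      by (simp add: h_def)
  qed
  have fh: "(\<lambda>x. f x * h n x) \<in> Cc B" for n
    unfolding h_def by (intro Cc_mult[OF f(1)] continuous_intros)
  have "indicator U x * ennreal (f x) = (SUP n. ennreal (f x * h n x))" for x
  proof (rule LIMSEQ_unique)
    have "(\<lambda>n. ennreal (f x * h n x)) \<longlonglongrightarrow> ennreal (f x * indicator U x)"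
      by (intro tendsto_ennrealI tendsto_mult lim tendsto_const)
    then show "(\<lambda>n. ennreal (f x * h n x)) \<longlonglongrightarrow> indicator U x * ennreal (f x)"
      by (cases "x \<in> U") simp_all
    show "(\<lambda>n. ennreal (f x * h n x)) \<longlonglongrightarrow> (SUP n. ennreal (f x * h n x))"
      using f(2) hm by (intro LIMSEQ_SUP) (auto simp: incseq_def intro!: ennreal_leI mult_left_mono)
  qed
  then have "(\<integral>\<^sup>+x. indicator U x * ennreal (f x) \<partial>T w) =
      (SUP n. \<integral>\<^sup>+x. ennreal (f x * h n x) \<partial>T w)" if "w \<in> space M" for w
    using f(2) hm Cc_measurable_Config[OF fh config_kernelD(1)[OF T that]]
    by (simp add: nn_integral_monotone_convergence_SUP incseq_def le_fun_def ennreal_leI mult_left_mono)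
  moreover have "(\<lambda>w. SUP n. \<integral>\<^sup>+x. ennreal (f x * h n x) \<partial>T w) \<in> borel_measurable M"
    using kernel_measurable_Cc[OF T fh] f(2) h0 by (intro borel_measurable_SUP) auto
  ultimately show ?thesis
    by (simp cong: measurable_cong)
qed

text \<open>Complements are handled by subtraction in the Dynkin arguments below, and subtraction in
  \<open>ennreal\<close> needs a finite subtrahend. The weight \<open>f\<close> provides it.\<close>

lemma kernel_fin:
  assumes T: "config_kernel M B T" and f: "f \<in> Cc B" "\<And>x. 0 \<le> f x" and w: "w \<in> space M"
    and le: "\<And>x. h x \<le> ennreal (f x)"
  shows "(\<integral>\<^sup>+x. h x \<partial>T w) < \<infinity>"
proof -
  have "(\<integral>\<^sup>+x. h x \<partial>T w) \<le> (\<integral>\<^sup>+x. ennreal (f x) \<partial>T w)"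
    by (intro nn_integral_mono le)
  also have "\<dots> = ennreal (\<integral>x. f x \<partial>T w)"
    using Cc_integrable[OF f(1) config_kernelD(1)[OF T w]] f(2)
    by (intro nn_integral_eq_integral) auto
  finally show ?thesis
    using le_less_trans by fastforce
qed

text \<open>Dynkin's lemma, started from the open sets, which form an intersection-stable
  generator.\<close>

lemma kernel_measurable_borel:
  assumes T: "config_kernel M B T" and f: "f \<in> Cc B" "\<And>x. 0 \<le> f x" and A: "A \<in> sets borel"
  shows "(\<lambda>w. \<integral>\<^sup>+x. indicator A x * ennreal (f x) \<partial>T w) \<in> borel_measurable M"
proof -
  have fm: "f \<in> borel_measurable (T w)" if "w \<in> space M" for w
    by (rule Cc_measurable_Config[OF f(1) config_kernelD(1)[OF T that]])
  have sm: "(\<lambda>x. indicator A x :: ennreal) \<in> borel_measurable (T w)"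
    if "w \<in> space M" "A \<in> sets borel" for w A
  proof -
    have "(\<lambda>x. indicator A x :: ennreal) \<in> borel_measurable (restrict_space borel B)"
      using that(2) by (intro measurable_restrict_space1) simp
    then show ?thesis
      using Config_sets[OF config_kernelD(1)[OF T that(1)]] by (simp cong: measurable_cong_sets)
  qed
  have "Int_stable {S :: 'b set. open S}" "{S :: 'b set. open S} \<subseteq> Pow UNIV"
      "A \<in> sigma_sets UNIV {S. open S}"
    using A by (auto simp: Int_stable_def borel_def)
  then show ?thesis
  proof (induction rule: sigma_sets_induct_disjoint)
    case (basic A)
    then show ?case
      by (intro kernel_measurable_open[OF T f]) simp
  next
    case empty
    then show ?case
      by simp
  next
    case (compl A)
    have As: "A \<in> sets borel"
      using compl(1) by (simp add: borel_def)
    have "(\<integral>\<^sup>+x. indicator (UNIV - A) x * ennreal (f x) \<partial>T w) =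
        (\<integral>\<^sup>+x. ennreal (f x) \<partial>T w) - (\<integral>\<^sup>+x. indicator A x * ennreal (f x) \<partial>T w)"
      if w: "w \<in> space M" for w
    proof -
      have "(\<integral>\<^sup>+x. indicator A x * ennreal (f x) \<partial>T w) < \<infinity>"
        by (rule kernel_fin[OF T f w]) (auto simp: indicator_def)
      then have "(\<integral>\<^sup>+x. ennreal (f x) - indicator A x * ennreal (f x) \<partial>T w) =
        (\<integral>\<^sup>+x. ennreal (f x) \<partial>T w) - (\<integral>\<^sup>+x. indicator A x * ennreal (f x) \<partial>T w)"
        using fm[OF w] sm[OF w As]
        by (intro nn_integral_diff) (auto simp: indicator_def)
      moreover have "indicator (UNIV - A) x * ennreal (f x) = ennreal (f x) - indicator A x * ennreal (f x)" for x
        by (auto simp: indicator_def)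
      ultimately show ?thesis
        by simp
    qed
    moreover have "(\<lambda>w. (\<integral>\<^sup>+x. ennreal (f x) \<partial>T w) - (\<integral>\<^sup>+x. indicator A x * ennreal (f x) \<partial>T w))
        \<in> borel_measurable M"
      using compl(2) kernel_measurable_Cc[OF T f] by measurable
    ultimately show ?case
      by (simp cong: measurable_cong)
  next
    case (union A)
    have As: "A i \<in> sets borel" for i
      using union(2) by (auto simp: borel_def)
    have "(\<integral>\<^sup>+x. indicator (\<Union>i. A i) x * ennreal (f x) \<partial>T w) =
        (\<Sum>i. \<integral>\<^sup>+x. indicator (A i) x * ennreal (f x) \<partial>T w)" if w: "w \<in> space M" for w
    proof -
      have "indicator (\<Union>i. A i) x * ennreal (f x) = (\<Sum>i. indicator (A i) x * ennreal (f x))" for x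
        using suminf_indicator[OF union(1), of x] by (simp add: ennreal_suminf_multc[symmetric])
      then have "(\<integral>\<^sup>+x. indicator (\<Union>i. A i) x * ennreal (f x) \<partial>T w) =
          (\<integral>\<^sup>+x. (\<Sum>i. indicator (A i) x * ennreal (f x)) \<partial>T w)"
        by (simp only:)
      also have "\<dots> = (\<Sum>i. \<integral>\<^sup>+x. indicator (A i) x * ennreal (f x) \<partial>T w)"
        using fm[OF w] sm[OF w As] by (intro nn_integral_suminf) simp
      finally show ?thesis .
    qed
    moreover have "(\<lambda>w. \<Sum>i. \<integral>\<^sup>+x. indicator (A i) x * ennreal (f x) \<partial>T w) \<in> borel_measurable M"
      using union(3) by measurable
    ultimately show ?case
      by (simp cong: measurable_cong)
  qed
qed

text \<open>Dynkin's lemma again, started from measurable rectangles: there the indicator in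
  \<open>w\<close> leaves the integral and the Borel case applies to the other side.\<close>

lemma kernel_measurable_prod:
  assumes T: "config_kernel M B T" and f: "f \<in> Cc B" "\<And>x. 0 \<le> f x"
    and A: "A \<in> sets (M \<Otimes>\<^sub>M restrict_space borel B)"
  shows "(\<lambda>w. \<integral>\<^sup>+x. indicator A (w, x) * ennreal (f x) \<partial>T w) \<in> borel_measurable M"
proof -
  let ?G = "{a \<times> b | a b. a \<in> sets M \<and> b \<in> sets (restrict_space borel B)}"
  have fm: "f \<in> borel_measurable (T w)" if "w \<in> space M" for w
    by (rule Cc_measurable_Config[OF f(1) config_kernelD(1)[OF T that]])
  have sm: "(\<lambda>x. indicator A (w, x) :: ennreal) \<in> borel_measurable (T w)"
    if "w \<in> space M" "A \<in> sets (M \<Otimes>\<^sub>M restrict_space borel B)" for w A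
    using that by (intro kernel_section_measurable[OF T]) auto
  note gen = Int_stable_pair_measure_generator[of M "restrict_space borel B"]
    pair_measure_closed[of M "restrict_space borel B", simplified]
  have "A \<in> sigma_sets (space M \<times> B) ?G"
    using A by (simp add: sets_pair_measure)
  with gen show ?thesis
  proof (induction rule: sigma_sets_induct_disjoint)
    case (basic A)
    then obtain a b' where ab: "A = a \<times> b'" "a \<in> sets M" "b' \<in> sets (restrict_space borel B)"
      by auto
    \<comment> \<open>Measurable subsets of \<open>B\<close> are traces of Borel sets; as
      \<open>T w\<close> lives on \<open>B\<close>, replacing \<open>b'\<close> by \<open>b\<close>
      does not change the integral.\<close>
    then obtain b where b: "b' = B \<inter> b" "b \<in> sets borel"
      by (auto simp: sets_restrict_space)
    have "(\<integral>\<^sup>+x. indicator A (w, x) * ennreal (f x) \<partial>T w) =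
        indicator a w * (\<integral>\<^sup>+x. indicator b x * ennreal (f x) \<partial>T w)" if w: "w \<in> space M" for w
    proof (cases "w \<in> a")
      case True
      then show ?thesis
        using config_kernelD(1)[OF T w]
        by (auto simp: ab(1) b(1) Config_space indicator_def intro!: nn_integral_cong)
    qed (simp add: ab(1))
    moreover have "(\<lambda>w. indicator a w * (\<integral>\<^sup>+x. indicator b x * ennreal (f x) \<partial>T w)) \<in> borel_measurable M"
      using kernel_measurable_borel[OF T f b(2)] ab(2) by measurable
    ultimately show ?case
      by (simp cong: measurable_cong)
  next
    case empty
    then show ?case
      by simp
  next
    case (compl A)
    have As: "A \<in> sets (M \<Otimes>\<^sub>M restrict_space borel B)"
      using compl(1) by (simp add: sets_pair_measure)
    have "(\<integral>\<^sup>+x. indicator (space M \<times> B - A) (w, x) * ennreal (f x) \<partial>T w) =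
        (\<integral>\<^sup>+x. ennreal (f x) \<partial>T w) - (\<integral>\<^sup>+x. indicator A (w, x) * ennreal (f x) \<partial>T w)"
      if w: "w \<in> space M" for w
    proof -
      have "(\<integral>\<^sup>+x. indicator A (w, x) * ennreal (f x) \<partial>T w) < \<infinity>"
        by (rule kernel_fin[OF T f w]) (auto simp: indicator_def)
      then have "(\<integral>\<^sup>+x. ennreal (f x) - indicator A (w, x) * ennreal (f x) \<partial>T w) =
        (\<integral>\<^sup>+x. ennreal (f x) \<partial>T w) - (\<integral>\<^sup>+x. indicator A (w, x) * ennreal (f x) \<partial>T w)"
        using fm[OF w] sm[OF w As]
        by (intro nn_integral_diff) (auto simp: indicator_def)
      moreover have "(\<integral>\<^sup>+x. indicator (space M \<times> B - A) (w, x) * ennreal (f x) \<partial>T w) =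
          (\<integral>\<^sup>+x. ennreal (f x) - indicator A (w, x) * ennreal (f x) \<partial>T w)"
        using w config_kernelD(1)[OF T w]
        by (intro nn_integral_cong) (auto simp: indicator_def Config_space)
      ultimately show ?thesis
        by simp
    qed
    moreover have "(\<lambda>w. (\<integral>\<^sup>+x. ennreal (f x) \<partial>T w) - (\<integral>\<^sup>+x. indicator A (w, x) * ennreal (f x) \<partial>T w))
        \<in> borel_measurable M"
      using compl(2) kernel_measurable_Cc[OF T f] by measurable
    ultimately show ?case
      by (simp cong: measurable_cong)
  next
    case (union A)
    have As: "A i \<in> sets (M \<Otimes>\<^sub>M restrict_space borel B)" for i
      using union(2) by (auto simp: sets_pair_measure)
    have "(\<integral>\<^sup>+x. indicator (\<Union>i. A i) (w, x) * ennreal (f x) \<partial>T w) =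
        (\<Sum>i. \<integral>\<^sup>+x. indicator (A i) (w, x) * ennreal (f x) \<partial>T w)" if w: "w \<in> space M" for w
    proof -
      have "indicator (\<Union>i. A i) (w, x) * ennreal (f x) = (\<Sum>i. indicator (A i) (w, x) * ennreal (f x))" for x
        using suminf_indicator[OF union(1), of "(w, x)"] by (simp add: ennreal_suminf_multc[symmetric])
      then have "(\<integral>\<^sup>+x. indicator (\<Union>i. A i) (w, x) * ennreal (f x) \<partial>T w) =
          (\<integral>\<^sup>+x. (\<Sum>i. indicator (A i) (w, x) * ennreal (f x)) \<partial>T w)"
        by (simp only:)
      also have "\<dots> = (\<Sum>i. \<integral>\<^sup>+x. indicator (A i) (w, x) * ennreal (f x) \<partial>T w)"
        using fm[OF w] sm[OF w As] by (intro nn_integral_suminf) simp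
      finally show ?thesis .
    qed
    moreover have "(\<lambda>w. \<Sum>i. \<integral>\<^sup>+x. indicator (A i) (w, x) * ennreal (f x) \<partial>T w) \<in> borel_measurable M"
      using union(3) by measurable
    ultimately show ?case
      by (simp cong: measurable_cong)
  qed
qed

lemma kernel_measurable_weighted:
  assumes T: "config_kernel M B T" and f: "f \<in> Cc B" "\<And>x. 0 \<le> f x"
    and h: "h \<in> borel_measurable (M \<Otimes>\<^sub>M restrict_space borel B)"
  shows "(\<lambda>w. \<integral>\<^sup>+x. h (w, x) * ennreal (f x) \<partial>T w) \<in> borel_measurable M"
  using h
proof (induction rule: borel_measurable_induct)
  have fm: "f \<in> borel_measurable (T w)" if "w \<in> space M" for w
    by (rule Cc_measurable_Config[OF f(1) config_kernelD(1)[OF T that]])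
  note sm = kernel_section_measurable[OF T]
  {
    case (cong h h')
    have "(\<integral>\<^sup>+x. h (w, x) * ennreal (f x) \<partial>T w) = (\<integral>\<^sup>+x. h' (w, x) * ennreal (f x) \<partial>T w)"
      if "w \<in> space M" for w
      using cong(3) that config_kernelD(1)[OF T that]
      by (intro nn_integral_cong) (auto simp: Config_space space_pair_measure)
    with cong(4) show ?case
      by (simp cong: measurable_cong)
  next
    case (set A)
    then show ?case
      by (rule kernel_measurable_prod[OF T f])
  next
    case (mult u c)
    have "(\<integral>\<^sup>+x. c * u (w, x) * ennreal (f x) \<partial>T w) = c * (\<integral>\<^sup>+x. u (w, x) * ennreal (f x) \<partial>T w)"
      if "w \<in> space M" for w
      using fm[OF that] sm[OF that mult(2)] by (simp add: mult.assoc nn_integral_cmult)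
    with mult(4) show ?case
      by (simp cong: measurable_cong)
  next
    case (add u v)
    have "(\<integral>\<^sup>+x. (v (w, x) + u (w, x)) * ennreal (f x) \<partial>T w) =
        (\<integral>\<^sup>+x. v (w, x) * ennreal (f x) \<partial>T w) + (\<integral>\<^sup>+x. u (w, x) * ennreal (f x) \<partial>T w)"
      if "w \<in> space M" for w
      using fm[OF that] sm[OF that add(1)] sm[OF that add(3)] by (simp add: distrib_right nn_integral_add)
    with add(6,7) show ?case
      by (simp cong: measurable_cong)
  next
    case (seq U)
    have "(\<integral>\<^sup>+x. (SUP i. U i) (w, x) * ennreal (f x) \<partial>T w) =
        (SUP i. \<integral>\<^sup>+x. U i (w, x) * ennreal (f x) \<partial>T w)" if "w \<in> space M" for w
    proof -
      have "(SUP i. U i) (w, x) * ennreal (f x) = (SUP i. U i (w, x) * ennreal (f x))" for x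
        by (simp add: SUP_apply image_comp SUP_mult_right_ennreal)
      then show ?thesis
        using fm[OF that] sm[OF that seq(1)] seq(3)
        by (simp add: nn_integral_monotone_convergence_SUP incseq_def le_fun_def mult_right_mono)
    qed
    moreover have "(\<lambda>w. SUP i. \<integral>\<^sup>+x. U i (w, x) * ennreal (f x) \<partial>T w) \<in> borel_measurable M"
      using seq(5) by measurable
    ultimately show ?case
      by (simp cong: measurable_cong)
  }
qed

text \<open>The weight is removed by letting the cutoffs increase. Their limit is the indicator of
  \<open>lc_part B\<close>, which is why this factor remains here and in the flux.\<close>

lemma kernel_measurable:
  assumes T: "config_kernel M B T" and h: "h \<in> borel_measurable (M \<Otimes>\<^sub>M restrict_space borel B)"
  shows "(\<lambda>w. \<integral>\<^sup>+x. h (w, x) * indicator (lc_part B) x \<partial>T w) \<in> borel_measurable M"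
proof -
  obtain g :: "nat \<Rightarrow> 'b \<Rightarrow> real" where g: "\<And>k. g k \<in> Cc B" "\<And>k x. 0 \<le> g k x"
    "\<And>x. incseq (\<lambda>k. g k x)" "\<And>x. x \<in> B \<Longrightarrow> (SUP k. ennreal (g k x)) = indicator (lc_part B) x"
    using cutoffs[of B] by metis
  have "(\<integral>\<^sup>+x. h (w, x) * indicator (lc_part B) x \<partial>T w) =
      (SUP k. \<integral>\<^sup>+x. h (w, x) * ennreal (g k x) \<partial>T w)" if w: "w \<in> space M" for w
  proof -
    have "(\<integral>\<^sup>+x. h (w, x) * indicator (lc_part B) x \<partial>T w) =
        (\<integral>\<^sup>+x. (SUP k. h (w, x) * ennreal (g k x)) \<partial>T w)"
      using g(4) config_kernelD(1)[OF T w]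
      by (intro nn_integral_cong) (simp add: Config_space flip: SUP_mult_left_ennreal)
    also have "\<dots> = (SUP k. \<integral>\<^sup>+x. h (w, x) * ennreal (g k x) \<partial>T w)"
      using g(3) Cc_measurable_Config[OF g(1) config_kernelD(1)[OF T w]]
        kernel_section_measurable[OF T w h]
      by (intro nn_integral_monotone_convergence_SUP)
        (auto simp: incseq_def le_fun_def intro!: mult_left_mono ennreal_leI)
    finally show ?thesis .
  qed
  moreover have "(\<lambda>w. SUP k. \<integral>\<^sup>+x. h (w, x) * ennreal (g k x) \<partial>T w) \<in> borel_measurable M"
    using kernel_measurable_weighted[OF T g(1,2) h] by measurable
  ultimately show ?thesis
    by (simp cong: measurable_cong)
qed


section \<open>The Borel algebra of the vague topology\<close>

text \<open>Prescribing exact numbers of atoms gives sets that need not be vaguely open. What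
  matters is that countably many of them suffice to write every vaguely open set as a union of
  finite intersections, and that a random configuration pulls them back to measurable sets.\<close>

definition count_set :: "'a::euclidean_space set \<Rightarrow> 'a set \<Rightarrow> nat \<Rightarrow> 'a measure set" where
  "count_set B Q m = {\<xi> \<in> Config B. emeasure \<xi> (lc_part B \<inter> Q) = of_nat m}"

definition count_family :: "'a::euclidean_space set \<Rightarrow> 'a measure set set" where
  "count_family B = (\<lambda>(Q, m). count_set B Q m) `
     (((SOME \<B>. countable \<B> \<and> topological_basis \<B>) \<union> range (\<lambda>n::nat. ball 0 (real n))) \<times> UNIV)"

text \<open>The intersection with \<open>Config B\<close> takes care of the empty \<open>F\<close>,
  for which \<open>\<Inter>F\<close> is \<open>UNIV\<close>.\<close>

definition count_base :: "'a::euclidean_space set \<Rightarrow> 'a measure set set" where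
  "count_base B = (\<lambda>F. Config B \<inter> \<Inter>F) ` {F. finite F \<and> F \<subseteq> count_family B}"

lemma some_basis:
  "countable (SOME \<B>. countable \<B> \<and> topological_basis (\<B> :: 'a::second_countable_topology set set))"
  "topological_basis (SOME \<B>. countable \<B> \<and> topological_basis (\<B> :: 'a set set))"
  using someI_ex[OF ex_countable_basis] by auto

lemma countable_count_family: "countable (count_family B)"
  unfolding count_family_def by (intro countable_image countable_SIGMA countable_Un) (auto simp: some_basis)

lemma countable_count_base: "countable (count_base B)"
  unfolding count_base_def
  by (intro countable_image countable_Collect_finite_subset countable_count_family)

lemma lc_part_Int_open: "open Q \<Longrightarrow> lc_part B \<inter> Q \<in> sets (restrict_space borel B)"
proof -
  assume "open Q"
  then have "B \<inter> Q \<in> sets (restrict_space borel B)"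
    by (auto simp: sets_restrict_space)
  then have "lc_part B \<inter> (B \<inter> Q) \<in> sets (restrict_space borel B)"
    by (rule sets.Int[OF lc_part_sets])
  moreover have "lc_part B \<inter> (B \<inter> Q) = lc_part B \<inter> Q"
    using lc_part_subset[of B] by auto
  ultimately show ?thesis
    by simp
qed

lemma lc_part_Int_open_bounded:
  assumes "open Q" "Q \<subseteq> ball 0 r"
  shows "lc_part B \<inter> Q \<in> bounded_borel B"
proof -
  have "bounded (lc_part B \<inter> Q)"
    by (rule bounded_subset[OF bounded_ball[of 0 r]]) (use assms(2) in auto)
  then show ?thesis
    using lc_part_Int_open[OF assms(1), of B] by (simp add: bounded_borel_def)
qed

text \<open>A configuration close to \<open>\<xi>\<close> has exactly one visible atom in each of finitely many small
  disjoint neighbourhoods of the visible atoms of \<open>\<xi>\<close> in a large ball, and no other in that ball.\<close>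

lemma vague_subbasis_nbhd:
  assumes f: "f \<in> Cc B" and U: "open U" and \<xi>: "\<xi> \<in> Config B" "(\<integral>x. f x \<partial>\<xi>) \<in> U"
  shows "\<exists>E\<in>count_base B. \<xi> \<in> E \<and> E \<subseteq> {\<xi> \<in> Config B. (\<integral>x. f x \<partial>\<xi>) \<in> U}"
proof -
  let ?\<B> = "SOME \<B>. countable \<B> \<and> topological_basis (\<B> :: 'a set set)"
  obtain e where e: "e > 0" "\<And>y. dist y (\<integral>x. f x \<partial>\<xi>) < e \<Longrightarrow> y \<in> U"
    using U \<xi>(2) by (auto simp: open_dist)
  have "bounded {x \<in> B. f x \<noteq> 0}"
    using Cc_supp[OF f] by (simp add: bounded_borel_def)
  then obtain r where r: "\<And>x. x \<in> B \<Longrightarrow> f x \<noteq> 0 \<Longrightarrow> norm x \<le> r"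
    by (auto simp: bounded_iff)
  obtain n :: nat where n: "r < real n"
    using reals_Archimedean2 by blast
  define Z where "Z = ball (0 :: 'a) (real n)"
  have Z: "open Z" "lc_part B \<inter> Z \<in> bounded_borel B"
    unfolding Z_def by (auto intro: lc_part_Int_open_bounded)
  have fZ: "f x = 0" if "x \<in> B - lc_part B \<inter> Z" for x
    using that r[of x] n Cc_nonzero_lc_part[OF f, of x] by (force simp: Z_def)
  define A where "A = atoms \<xi> \<inter> (lc_part B \<inter> Z)"
  have A: "finite A"
    unfolding A_def by (rule finite_atoms[OF \<xi>(1) Z(2)])
  \<comment> \<open>The error is shared among the points of \<open>A\<close>; the extra 1 covers an
    empty \<open>A\<close> and keeps the final inequality strict.\<close>
  define d where "d = e / (real (card A) + 1)"
  have d: "d > 0"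
    using e by (simp add: d_def)
  \<comment> \<open>Half the distance to each other point of \<open>A\<close> makes the chosen
    neighbourhoods pairwise disjoint, so atoms of a nearby configuration can be matched to points of
    \<open>A\<close> without ambiguity.\<close>
  define good where "good x Q \<longleftrightarrow> Q \<in> ?\<B> \<and> x \<in> Q \<and> Q \<subseteq> Z \<and> (\<forall>y\<in>B \<inter> Q. \<bar>f y - f x\<bar> < d) \<and>
      (\<forall>y\<in>A. y \<noteq> x \<longrightarrow> Q \<subseteq> ball x (dist x y / 2))" for x Q
  have "\<exists>Q. good x Q" if x: "x \<in> A" for x
  proof -
    have "x \<in> B" "x \<in> Z"
      using x lc_part_subset[of B] by (auto simp: A_def)
    moreover have "continuous_on B f"
      using f by (simp add: Cc_def)
    ultimately obtain s where s: "s > 0" "\<And>y. y \<in> B \<Longrightarrow> dist y x < s \<Longrightarrow> dist (f y) (f x) < d"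
      using d unfolding continuous_on_iff by metis
    define N where "N = Z \<inter> ball x s \<inter> (\<Inter>y\<in>A - {x}. ball x (dist x y / 2))"
    have "open N" "x \<in> N"
      using A Z(1) s(1) \<open>x \<in> Z\<close> by (auto simp: N_def intro!: open_INT)
    then obtain Q where Q: "Q \<in> ?\<B>" "x \<in> Q" "Q \<subseteq> N"
      using topological_basisE[OF some_basis(2)] by metis
    then show ?thesis
      using s(2) by (intro exI[of _ Q]) (auto simp: good_def N_def dist_real_def dist_commute subset_iff)
  qed
  then obtain Q where "\<And>x. x \<in> A \<Longrightarrow> good x (Q x)"
    by metis
  then have Q: "\<And>x. x \<in> A \<Longrightarrow> Q x \<in> ?\<B>" "\<And>x. x \<in> A \<Longrightarrow> x \<in> Q x"
    "\<And>x. x \<in> A \<Longrightarrow> Q x \<subseteq> Z" "\<And>x y. x \<in> A \<Longrightarrow> y \<in> B \<inter> Q x \<Longrightarrow> \<bar>f y - f x\<bar> < d"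
    "\<And>x y. x \<in> A \<Longrightarrow> y \<in> A \<Longrightarrow> y \<noteq> x \<Longrightarrow> Q x \<subseteq> ball x (dist x y / 2)"
    unfolding good_def by blast+
  have disj: "x = y" if "x \<in> A" "y \<in> A" "z \<in> Q x" "z \<in> Q y" for x y z
  proof (rule ccontr)
    assume "x \<noteq> y"
    then have "dist x z < dist x y / 2" "dist y z < dist y x / 2"
      using Q(5)[of x y] Q(5)[of y x] that by auto
    then show False
      using dist_triangle_half_r[of z x "dist x y" y] by (simp add: dist_commute)
  qed
  have QB: "lc_part B \<inter> Q x \<in> bounded_borel B" if "x \<in> A" for x
    using Q(3)[OF that] topological_basis_open[OF some_basis(2) Q(1)[OF that]]
    by (intro lc_part_Int_open_bounded[where r = "real n"]) (auto simp: Z_def)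
  define F where "F = insert (count_set B Z (card A)) ((\<lambda>x. count_set B (Q x) 1) ` A)"
  have "F \<subseteq> count_family B"
    using Q(1) unfolding F_def count_family_def Z_def by auto
  moreover have "finite F"
    using A by (simp add: F_def)
  ultimately have "Config B \<inter> \<Inter>F \<in> count_base B"
    by (auto simp: count_base_def)
  moreover have "\<xi> \<in> Config B \<inter> \<Inter>F"
  proof -
    have "emeasure \<xi> (lc_part B \<inter> Q x) = of_nat 1" if "x \<in> A" for x
    proof -
      have "atoms \<xi> \<inter> (lc_part B \<inter> Q x) = {x}"
      proof -
        have "y = x" if "y \<in> atoms \<xi> \<inter> (lc_part B \<inter> Q x)" for y
        proof -
          have "y \<in> A"
            using that Q(3)[OF \<open>x \<in> A\<close>] by (auto simp: A_def)
          then show ?thesis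
            using disj[of x y y] that \<open>x \<in> A\<close> Q(2) by auto
        qed
        then show ?thesis
          using that Q(2)[OF that] by (auto simp: A_def)
      qed
      then show ?thesis
        using emeasure_Config[OF \<xi>(1) QB[OF that]] by simp
    qed
    moreover have "emeasure \<xi> (lc_part B \<inter> Z) = of_nat (card A)"
      using emeasure_Config[OF \<xi>(1) Z(2)] by (simp add: A_def)
    ultimately show ?thesis
      using \<xi>(1) by (auto simp: F_def count_set_def)
  qed
  moreover have "(\<integral>x. f x \<partial>\<eta>) \<in> U" if \<eta>: "\<eta> \<in> Config B" "\<eta> \<in> \<Inter>F" for \<eta>
  proof (rule e(2))
    let ?A = "atoms \<eta> \<inter> (lc_part B \<inter> Z)"
    have "card (atoms \<eta> \<inter> (lc_part B \<inter> Q x)) = 1" if "x \<in> A" for x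
    proof -
      have "(of_nat (card (atoms \<eta> \<inter> (lc_part B \<inter> Q x))) :: ennreal) = of_nat 1"
        using \<eta> that emeasure_Config[OF \<eta>(1) QB[OF that]] by (simp add: F_def count_set_def)
      then show ?thesis
        by (simp only: of_nat_eq_iff)
    qed
    then have "\<exists>p. atoms \<eta> \<inter> (lc_part B \<inter> Q x) = {p}" if "x \<in> A" for x
      using that card_1_singletonE by metis
    then obtain p where p: "\<And>x. x \<in> A \<Longrightarrow> atoms \<eta> \<inter> (lc_part B \<inter> Q x) = {p x}"
      by metis
    have pQ: "p x \<in> Q x" "p x \<in> ?A" if "x \<in> A" for x
      using p[OF that] Q(3)[OF that] by auto
    have inj: "inj_on p A"
      using disj pQ(1) by (auto simp: inj_on_def) metis
    \<comment> \<open>\<open>p\<close> yields \<open>card A\<close> distinct atoms of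
      \<open>\<eta>\<close> in the visible part of \<open>Z\<close>, and \<open>\<eta>\<close> has
      only that many there. So \<open>p\<close> reaches all of them, and both integrals become sums
      over \<open>A\<close>.\<close>
    have "(of_nat (card ?A) :: ennreal) = of_nat (card A)"
      using \<eta> emeasure_Config[OF \<eta>(1) Z(2)] by (simp add: F_def count_set_def)
    then have "card ?A = card (p ` A)"
      by (simp only: of_nat_eq_iff card_image[OF inj])
    then have pA: "p ` A = ?A"
      using pQ(2) finite_atoms[OF \<eta>(1) Z(2)] by (intro card_subset_eq) auto
    have "(\<integral>x. f x \<partial>\<eta>) = (\<Sum>x\<in>A. f (p x))"
      using integral_Config[OF f \<eta>(1) Z(2) fZ] sum.reindex[OF inj, of f] by (simp add: pA)
    moreover have "(\<integral>x. f x \<partial>\<xi>) = (\<Sum>x\<in>A. f x)"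
      using integral_Config[OF f \<xi>(1) Z(2) fZ] by (simp add: A_def)
    ultimately have "dist (\<integral>x. f x \<partial>\<eta>) (\<integral>x. f x \<partial>\<xi>) = \<bar>\<Sum>x\<in>A. f (p x) - f x\<bar>"
      by (simp add: dist_real_def sum_subtractf)
    also have "\<dots> \<le> (\<Sum>x\<in>A. \<bar>f (p x) - f x\<bar>)"
      by (rule sum_abs)
    also have "\<dots> \<le> (\<Sum>x\<in>A. d)"
      using Q(4) pQ lc_part_subset[of B] by (intro sum_mono less_imp_le) blast
    also have "\<dots> < e"
      using e(1) by (simp add: d_def field_simps)
    finally show "dist (\<integral>x. f x \<partial>\<eta>) (\<integral>x. f x \<partial>\<xi>) < e" .
  qed
  ultimately show ?thesis
    by (intro bexI[of _ "Config B \<inter> \<Inter>F"]) auto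
qed

text \<open>Induction on the generation of the topology. Intersections are handled by joining the
  two finite families of counting events; generators are the previous lemma.\<close>

lemma vague_open_nbhd:
  assumes "openin (vague_topology B) G" "\<xi> \<in> G"
  shows "\<exists>E\<in>count_base B. \<xi> \<in> E \<and> E \<subseteq> G"
  using assms unfolding vague_topology_def openin_topology_generated_by_iff
proof (induction arbitrary: \<xi> rule: generate_topology_on.induct)
  case (Int G H)
  have "\<xi> \<in> G" "\<xi> \<in> H"
    using Int.prems by auto
  obtain E1 where E1: "E1 \<in> count_base B" "\<xi> \<in> E1" "E1 \<subseteq> G"
    using Int.IH(1)[OF \<open>\<xi> \<in> G\<close>] by blast
  obtain E2 where E2: "E2 \<in> count_base B" "\<xi> \<in> E2" "E2 \<subseteq> H"
    using Int.IH(2)[OF \<open>\<xi> \<in> H\<close>] by blast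
  from E1 E2 obtain F1 F2 where F: "finite F1" "F1 \<subseteq> count_family B" "E1 = Config B \<inter> \<Inter>F1"
    "finite F2" "F2 \<subseteq> count_family B" "E2 = Config B \<inter> \<Inter>F2"
    by (auto simp: count_base_def)
  have "E1 \<inter> E2 = Config B \<inter> \<Inter>(F1 \<union> F2)"
    by (auto simp: F)
  then have "E1 \<inter> E2 \<in> count_base B"
    using F unfolding count_base_def by (intro image_eqI[of _ _ "F1 \<union> F2"]) auto
  with E1 E2 show ?case
    by (intro bexI[of _ "E1 \<inter> E2"]) auto
next
  case (UN K)
  then obtain k where "k \<in> K" "\<xi> \<in> k"
    by auto
  with UN.IH[of k \<xi>] show ?case
    by blast
next
  case (Basis s)
  then obtain f U where "f \<in> Cc B" "open U" "s = {\<xi> \<in> Config B. (\<integral>x. f x \<partial>\<xi>) \<in> U}"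
    by blast
  with Basis.prems vague_subbasis_nbhd[of f B U \<xi>] show ?case
    by simp
qed simp

section \<open>Measurable maps into the space of configurations\<close>

lemma kernel_count_measurable:
  assumes T: "config_kernel M B T" and Q: "open Q"
  shows "(\<lambda>w. emeasure (T w) (lc_part B \<inter> Q)) \<in> borel_measurable M"
proof -
  have [measurable]: "B \<inter> Q \<in> sets (restrict_space borel B)"
    using Q by (auto simp: sets_restrict_space)
  have "(\<lambda>w. \<integral>\<^sup>+x. indicator (B \<inter> Q) (snd (w, x)) * indicator (lc_part B) x \<partial>T w) \<in> borel_measurable M"
    by (rule kernel_measurable[OF T]) measurable
  moreover have "(\<integral>\<^sup>+x. indicator (B \<inter> Q) (snd (w, x)) * indicator (lc_part B) x \<partial>T w) =
      emeasure (T w) (lc_part B \<inter> Q)" if w: "w \<in> space M" for w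
  proof -
    have "(\<integral>\<^sup>+x. indicator (B \<inter> Q) (snd (w, x)) * indicator (lc_part B) x \<partial>T w) =
        (\<integral>\<^sup>+x. indicator (lc_part B \<inter> Q) x \<partial>T w)"
      using lc_part_subset[of B] by (intro nn_integral_cong) (auto simp: indicator_def)
    then show ?thesis
      using lc_part_Int_open[OF Q, of B] Config_sets[OF config_kernelD(1)[OF T w]] by simp
  qed
  ultimately show ?thesis
    by (simp cong: measurable_cong)
qed

text \<open>A vaguely open set is the union of those members of a countable base that it contains,
  so its preimage is a countable union of preimages of counting events.\<close>

lemma config_kernel_imp_measurable:
  assumes T: "config_kernel M B T"
  shows "T \<in> measurable M (config_algebra B)"
proof (rule measurable_sigma_sets[OF sets_config_algebra config_algebra_subset])
  show "T \<in> space M \<rightarrow> Config B"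
    using config_kernelD(1)[OF T] by auto
  fix G assume "G \<in> {G. openin (vague_topology B) G}"
  then have G: "openin (vague_topology B) G"
    by simp
  have fam: "T -` E \<inter> space M \<in> sets M" if E: "E \<in> count_family B" for E
  proof -
    obtain Q m where Q: "open Q" "E = count_set B Q m"
      using E topological_basis_open[OF some_basis(2)] by (auto simp: count_family_def)
    have "T -` E \<inter> space M = {w \<in> space M. emeasure (T w) (lc_part B \<inter> Q) = of_nat m}"
      using config_kernelD(1)[OF T] by (auto simp: Q(2) count_set_def)
    also have "\<dots> \<in> sets M"
      using kernel_count_measurable[OF T Q(1)] by measurable
    finally show ?thesis .
  qed
  have base: "T -` E \<inter> space M \<in> sets M" if E: "E \<in> count_base B" for E
  proof -
    obtain F where F: "finite F" "F \<subseteq> count_family B" "E = Config B \<inter> \<Inter>F"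
      using E by (auto simp: count_base_def)
    have "T -` E \<inter> space M = space M \<inter> (\<Inter>H\<in>F. T -` H \<inter> space M)"
      using config_kernelD(1)[OF T] by (auto simp: F(3))
    also have "\<dots> \<in> sets M"
    proof (cases "F = {}")
      case False
      then have "(\<Inter>H\<in>F. T -` H \<inter> space M) \<in> sets M"
        using F(1,2) fam by (intro sets.finite_INT) auto
      then show ?thesis
        by (rule sets.Int[OF sets.top])
    qed simp
    finally show ?thesis .
  qed
  have "T -` G \<inter> space M = (\<Union>E\<in>{E \<in> count_base B. E \<subseteq> G}. T -` E \<inter> space M)"
    using vague_open_nbhd[OF G] by blast
  also have "\<dots> \<in> sets M"
    using base countable_count_base[of B] by (intro sets.countable_UN') auto
  finally show "T -` G \<inter> space M \<in> sets M" .
qed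

lemma vague_continuous_measurable:
  assumes "continuous_map (vague_topology B) euclideanreal F"
  shows "F \<in> borel_measurable (config_algebra B)"
proof (rule borel_measurableI)
  fix S :: "real set" assume "open S"
  then have "openin (vague_topology B) {\<xi> \<in> Config B. F \<xi> \<in> S}"
    using assms by (auto simp: continuous_map_def)
  moreover have "{\<xi> \<in> Config B. F \<xi> \<in> S} = F -` S \<inter> space (config_algebra B)"
    by auto
  ultimately show "F -` S \<inter> space (config_algebra B) \<in> sets (config_algebra B)"
    by (auto simp: sets_config_algebra)
qed

lemma vague_continuous_integral:
  assumes "f \<in> Cc B"
  shows "continuous_map (vague_topology B) euclideanreal (\<lambda>\<xi>. \<integral>x. f x \<partial>\<xi>)"
  unfolding continuous_map_def
proof (intro conjI allI impI)
  fix U assume "openin euclideanreal U"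
  then show "openin (vague_topology B) {\<xi> \<in> topspace (vague_topology B). (\<integral>x. f x \<partial>\<xi>) \<in> U}"
    using assms unfolding topspace_vague_topology
    by (subst vague_topology_def) (rule topology_generated_by_Basis, auto)
qed auto

lemma config_kernel_id: "config_kernel (config_algebra B) B (\<lambda>\<xi>. \<xi>)"
  using vague_continuous_measurable[OF vague_continuous_integral]
  by (auto simp: config_kernel_def)


section \<open>Adding points and removing the future\<close>

lemma add_point_eq_lincomb: "add_point \<xi> z = lincomb 1 1 \<xi> (return \<xi> z)"
  unfolding add_point_def lincomb_def
  by (rule measure_of_eq) (auto simp: sets.space_closed sets.sigma_sets_eq)

text \<open>The integral is additive in the measure, so an extra point at \<open>z\<close>
  multiplies \<open>laplace f\<close> by \<open>exp (- f z)\<close>. This remains true if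
  \<open>\<xi>\<close> already has an atom at \<open>z\<close> and the sum is not simple.\<close>

lemma diff_op_laplace:
  assumes f: "f \<in> Cc B" and \<xi>: "\<xi> \<in> Config B" and z: "z \<in> B"
  shows "diff_op z (laplace f) \<xi> = - ((1 - exp (- f z)) * laplace f \<xi>)"
proof -
  have fm: "f \<in> borel_measurable \<xi>"
    by (rule Cc_measurable_Config[OF f \<xi>])
  have zs: "z \<in> space \<xi>"
    using z \<xi> by (simp add: Config_space)
  have "integrable (return \<xi> z) f"
    using fm zs by (intro integrableI_bounded) (auto simp: nn_integral_return)
  then have "(\<integral>x. f x \<partial>add_point \<xi> z) = (\<integral>x. f x \<partial>\<xi>) + f z"
    unfolding add_point_eq_lincomb
    using fm zs Cc_integrable[OF f \<xi>] by (subst integrable_lincomb) (auto simp: integral_return)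
  then show ?thesis
    by (simp add: diff_op_def laplace_def algebra_simps flip: exp_add)
qed

text \<open>Using a density instead of a restricted space keeps the sigma-algebra of
  \<open>\<xi>\<close>, so the result is again a configuration on all of \<open>B\<close>. As the
  order is strict, \<open>x\<close> itself is left out and is the point to be added next.\<close>

definition past :: "'a::euclidean_space measure \<Rightarrow> 'a \<Rightarrow> 'a measure" where
  "past \<xi> x = density \<xi> (indicator {y. lexless y x})"

lemma lexless_sets [measurable]: "{y. lexless y x} \<in> sets borel"
  by measurable

lemma Config_indicator_measurable:
  assumes "\<xi> \<in> Config B" "A \<in> sets borel"
  shows "(indicator A :: _ \<Rightarrow> ennreal) \<in> borel_measurable \<xi>"
proof -
  have "(indicator A :: _ \<Rightarrow> ennreal) \<in> borel_measurable (restrict_space borel B)"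
    using assms(2) by (intro measurable_restrict_space1) simp
  then show ?thesis
    using Config_sets[OF assms(1)] by (simp cong: measurable_cong_sets)
qed

lemma sets_past [simp]: "sets (past \<xi> x) = sets \<xi>"
  by (simp add: past_def)

lemma emeasure_past:
  assumes \<xi>: "\<xi> \<in> Config B" and A: "A \<in> sets (restrict_space borel B)"
  shows "emeasure (past \<xi> x) A = emeasure \<xi> (A \<inter> {y. lexless y x})"
proof -
  have "A \<subseteq> B"
    using sets.sets_into_space[OF A] by simp
  moreover obtain A' where "A = B \<inter> A'" "A' \<in> sets borel"
    using A by (auto simp: sets_restrict_space)
  ultimately have "A \<inter> {y. lexless y x} \<in> sets (restrict_space borel B)"
    by (auto simp: sets_restrict_space intro!: image_eqI[of _ _ "A' \<inter> {y. lexless y x}"] sets.Int)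
  moreover have "emeasure (past \<xi> x) A = (\<integral>\<^sup>+y. indicator (A \<inter> {y. lexless y x}) y \<partial>\<xi>)"
  proof -
    have "emeasure (past \<xi> x) A = (\<integral>\<^sup>+y. indicator {y. lexless y x} y * indicator A y \<partial>\<xi>)"
      unfolding past_def using A \<xi> Config_indicator_measurable[OF \<xi> lexless_sets]
      by (intro emeasure_density) (auto simp: Config_sets)
    also have "\<dots> = (\<integral>\<^sup>+y. indicator (A \<inter> {y. lexless y x}) y \<partial>\<xi>)"
      by (intro nn_integral_cong) (auto simp: indicator_def)
    finally show ?thesis .
  qed
  ultimately show ?thesis
    using \<xi> by (simp add: Config_sets)
qed

lemma bounded_borel_Int_borel:
  assumes "D \<in> bounded_borel B" "A \<in> sets borel"
  shows "D \<inter> A \<in> bounded_borel B"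
proof -
  obtain D' where "D = B \<inter> D'" "D' \<in> sets borel"
    using assms(1) by (auto simp: bounded_borel_def sets_restrict_space)
  then have "D \<inter> A \<in> sets (restrict_space borel B)"
    using assms(2) by (auto simp: sets_restrict_space intro!: image_eqI[of _ _ "D' \<inter> A"])
  then show ?thesis
    by (rule bounded_borel_subset[OF assms(1)]) simp
qed

lemma past_Config:
  assumes \<xi>: "\<xi> \<in> Config B"
  shows "past \<xi> x \<in> Config B"
  unfolding Config_def mem_Collect_eq
proof (intro conjI ballI)
  show "sets (past \<xi> x) = sets (restrict_space borel B)"
    using \<xi> by (simp add: Config_sets)
  show "emeasure (past \<xi> x) D \<in> \<nat>" if D: "D \<in> bounded_borel B" for D
    using Config_Nats[OF \<xi> bounded_borel_Int_borel[OF D lexless_sets]] D emeasure_past[OF \<xi>]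
    by (simp add: bounded_borel_def)
  show "emeasure (past \<xi> x) {y} \<le> 1" if y: "y \<in> B" for y
  proof -
    have s: "{y} \<in> sets (restrict_space borel B)"
      using singleton_bounded_borel[OF y] by (simp add: bounded_borel_def)
    have "emeasure (past \<xi> x) {y} \<le> emeasure \<xi> {y}"
      unfolding emeasure_past[OF \<xi> s] using s \<xi> by (intro emeasure_mono) (auto simp: Config_sets)
    also have "\<dots> \<le> 1"
      using \<xi> y by (simp add: Config_def)
    finally show ?thesis .
  qed
qed

lemma atoms_past:
  assumes \<xi>: "\<xi> \<in> Config B"
  shows "atoms (past \<xi> x) = {y \<in> atoms \<xi>. lexless y x}"
proof -
  have "emeasure (past \<xi> x) {y} = (if lexless y x then emeasure \<xi> {y} else 0)" if y: "y \<in> B" for y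
    using emeasure_past[OF \<xi>, of "{y}" x] singleton_bounded_borel[OF y]
    by (auto simp: bounded_borel_def)
  then show ?thesis
    using Config_space[OF \<xi>] Config_space[OF past_Config[OF \<xi>, of x]] by (auto simp: atoms_def split: if_splits)
qed

lemma config_kernel_fst:
  "config_kernel (config_algebra B \<Otimes>\<^sub>M N) B fst"
  using config_kernel_id[of B] unfolding config_kernel_def
  by (auto simp: space_pair_measure intro!: measurable_compose[OF measurable_fst])

lemma restrict_borel_ident [measurable]: "(\<lambda>x. x) \<in> borel_measurable (restrict_space borel B)"
  by (rule measurable_restrict_space1) simp

text \<open>Integrating over the past of \<open>x\<close> means integrating over
  \<open>\<xi>\<close> against the indicator of a measurable relation. The pair \<open>p\<close> is
  taken as parameter and \<open>fst p\<close> as kernel; the positive and negative parts of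
  \<open>f\<close> are treated separately because the kernel lemmas concern nonnegative
  integrals.\<close>

lemma config_kernel_past:
  "config_kernel (config_algebra B \<Otimes>\<^sub>M restrict_space borel B) B (\<lambda>p. past (fst p) (snd p))"
  unfolding config_kernel_def
proof (intro conjI ballI)
  let ?M = "config_algebra B \<Otimes>\<^sub>M restrict_space borel B"
  show "past (fst p) (snd p) \<in> Config B" if "p \<in> space ?M" for p
    using that by (auto simp: space_pair_measure past_Config)
  fix f assume f: "f \<in> Cc B"
  have [measurable]: "f \<in> borel_measurable (restrict_space borel B)"
    by (rule Cc_measurable[OF f])
  have snd_fst [measurable]: "(\<lambda>w. snd (fst w)) \<in> borel_measurable (?M \<Otimes>\<^sub>M restrict_space borel B)"
    by (rule measurable_compose[OF _ restrict_borel_ident]) measurable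
  have snd [measurable]: "(\<lambda>w. snd w) \<in> borel_measurable (?M \<Otimes>\<^sub>M restrict_space borel B)"
    by (rule measurable_compose[OF _ restrict_borel_ident]) measurable
  have meas: "(\<lambda>p. \<integral>\<^sup>+y. ennreal (g y) \<partial>past (fst p) (snd p)) \<in> borel_measurable ?M"
    if [measurable]: "g \<in> borel_measurable (restrict_space borel B)"
      and g: "\<And>x. x \<in> B - lc_part B \<Longrightarrow> g x = 0" for g
  proof -
    let ?h = "\<lambda>w. ennreal (g (snd w)) * indicator {w. lexless (snd w) (snd (fst w))} w"
    have "?h \<in> borel_measurable (?M \<Otimes>\<^sub>M restrict_space borel B)"
      by measurable
    then have "(\<lambda>p. \<integral>\<^sup>+y. ?h (p, y) * indicator (lc_part B) y \<partial>fst p) \<in> borel_measurable ?M"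
      by (rule kernel_measurable[OF config_kernel_fst])
    moreover have "(\<integral>\<^sup>+y. ?h (p, y) * indicator (lc_part B) y \<partial>fst p) =
        (\<integral>\<^sup>+y. ennreal (g y) \<partial>past (fst p) (snd p))" if "p \<in> space ?M" for p
    proof -
      have \<xi>: "fst p \<in> Config B"
        using that by (auto simp: space_pair_measure)
      have "g \<in> borel_measurable (fst p)"
        using Config_sets[OF \<xi>] by (simp cong: measurable_cong_sets)
      then have "(\<integral>\<^sup>+y. ennreal (g y) \<partial>past (fst p) (snd p)) =
          (\<integral>\<^sup>+y. indicator {y. lexless y (snd p)} y * ennreal (g y) \<partial>fst p)"
        unfolding past_def using Config_indicator_measurable[OF \<xi> lexless_sets]
        by (intro nn_integral_density) auto
      also have "\<dots> = (\<integral>\<^sup>+y. ?h (p, y) * indicator (lc_part B) y \<partial>fst p)"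
        using g \<xi> by (intro nn_integral_cong) (auto simp: indicator_def Config_space)
      finally show ?thesis
        by simp
    qed
    ultimately show ?thesis
      by (simp cong: measurable_cong)
  qed
  have z: "f x = 0" if "x \<in> B - lc_part B" for x
    using that Cc_nonzero_lc_part[OF f, of x] by auto
  have [measurable]: "(\<lambda>p. \<integral>\<^sup>+y. ennreal (f y) \<partial>past (fst p) (snd p)) \<in> borel_measurable ?M"
    "(\<lambda>p. \<integral>\<^sup>+y. ennreal (- f y) \<partial>past (fst p) (snd p)) \<in> borel_measurable ?M"
    by (rule meas; use z in simp)+
  have "(\<lambda>p. enn2real (\<integral>\<^sup>+y. ennreal (f y) \<partial>past (fst p) (snd p)) -
      enn2real (\<integral>\<^sup>+y. ennreal (- f y) \<partial>past (fst p) (snd p))) \<in> borel_measurable ?M"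
    by measurable
  moreover have "(\<integral>x. f x \<partial>past (fst p) (snd p)) =
      enn2real (\<integral>\<^sup>+y. ennreal (f y) \<partial>past (fst p) (snd p)) -
      enn2real (\<integral>\<^sup>+y. ennreal (- f y) \<partial>past (fst p) (snd p))" if "p \<in> space ?M" for p
    using that by (intro real_lebesgue_integral_def Cc_integrable[OF f] past_Config)
      (auto simp: space_pair_measure)
  ultimately show "(\<lambda>p. \<integral>x. f x \<partial>past (fst p) (snd p)) \<in> borel_measurable ?M"
    by (simp cong: measurable_cong)
qed

lemma past_pair_measurable:
  "(\<lambda>p. (past (fst p) (snd p), snd p)) \<in>
    measurable (config_algebra B \<Otimes>\<^sub>M restrict_space borel B) (field_algebra B)"
  unfolding field_algebra_def
  by (intro measurable_Pair config_kernel_imp_measurable[OF config_kernel_past] measurable_snd)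


section \<open>The flux from the empty configuration\<close>

text \<open>Remove the largest point \<open>m\<close>. Its past is everything else, and it lies in
  no other past. Its term is the difference of the exponentials without and with \<open>m\<close>,
  which is the increment that the induction hypothesis lacks.\<close>

lemma finite_lex_telescope:
  fixes f :: "'a::euclidean_space \<Rightarrow> real"
  assumes "finite A"
  shows "(\<Sum>x\<in>A. (1 - exp (- f x)) * exp (- (\<Sum>y\<in>{y \<in> A. lexless y x}. f y))) = 1 - exp (- sum f A)"
  using assms
proof (induction "card A" arbitrary: A)
  case 0
  then show ?case
    by simp
next
  case (Suc n)
  then have "A \<noteq> {}"
    by auto
  have "\<exists>m\<in>A. \<forall>x\<in>A. x \<noteq> m \<longrightarrow> lexless x m"
    using Suc.prems \<open>A \<noteq> {}\<close>
    by (intro Finite_Set.bex_greatest_element)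
      (auto simp: transp_on_def totalp_on_def dest: lexless_trans lexless_total)
  then obtain m where m: "m \<in> A" "\<And>x. x \<in> A \<Longrightarrow> x \<noteq> m \<Longrightarrow> lexless x m"
    by blast
  define A' where "A' = A - {m}"
  have A: "A = insert m A'" "m \<notin> A'" "finite A'" "card A' = n"
    using m Suc by (auto simp: A'_def)
  have "{y \<in> A. lexless y m} = A'"
    using m by (auto simp: A'_def)
  moreover have "{y \<in> A. lexless y x} = {y \<in> A'. lexless y x}" if "x \<in> A'" for x
    using that m(2)[of x] lexless_trans[of x m x] by (auto simp: A'_def)
  ultimately have "(\<Sum>x\<in>A. (1 - exp (- f x)) * exp (- (\<Sum>y\<in>{y \<in> A. lexless y x}. f y))) =
      (1 - exp (- f m)) * exp (- sum f A') +
      (\<Sum>x\<in>A'. (1 - exp (- f x)) * exp (- (\<Sum>y\<in>{y \<in> A'. lexless y x}. f y)))"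
    using A by (subst (1) A(1)) (simp add: sum.insert)
  also have "\<dots> = 1 - exp (- sum f A)"
    using A Suc.hyps(1)[OF A(4)[symmetric] A(3)] by (simp add: algebra_simps flip: exp_add)
  finally show ?case .
qed

lemma laplace_past_measurable:
  assumes "f \<in> Cc B" "\<xi> \<in> Config B"
  shows "(\<lambda>x. laplace f (past \<xi> x)) \<in> borel_measurable (restrict_space borel B)"
proof -
  have "(\<lambda>p. \<integral>y. f y \<partial>past (fst p) (snd p)) \<in> borel_measurable (config_algebra B \<Otimes>\<^sub>M restrict_space borel B)"
    by (rule config_kernelD(2)[OF config_kernel_past assms(1)])
  then have "(\<lambda>x. \<integral>y. f y \<partial>past (fst (\<xi>, x)) (snd (\<xi>, x))) \<in> borel_measurable (restrict_space borel B)"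
    by (rule measurable_compose[rotated]) (use assms in \<open>auto intro: measurable_Pair1'\<close>)
  then show ?thesis
    unfolding laplace_def by simp
qed

text \<open>The factor \<open>1 - exp (- f x)\<close> vanishes off \<open>?D\<close>, and the
  integral of \<open>f\<close> over a past sees only atoms in \<open>?D\<close>, so the finite
  identity applies. Atoms in \<open>?D\<close> lie in \<open>lc_part B\<close>, whose indicator is
  therefore 1 in every term.\<close>

lemma laplace_telescope:
  assumes f: "f \<in> Cc B" "\<And>x. x \<in> B \<Longrightarrow> 0 \<le> f x" and \<xi>: "\<xi> \<in> Config B"
  shows "(\<integral>\<^sup>+x. ennreal ((1 - exp (- f x)) * laplace f (past \<xi> x)) * indicator (lc_part B) x \<partial>\<xi>) =
    ennreal (1 - laplace f \<xi>)"
proof -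
  let ?D = "{x \<in> B. f x \<noteq> 0}"
  let ?A = "atoms \<xi> \<inter> ?D"
  have D: "?D \<in> bounded_borel B"
    by (rule Cc_supp[OF f(1)])
  have [measurable]: "f \<in> borel_measurable (restrict_space borel B)"
    "(\<lambda>x. laplace f (past \<xi> x)) \<in> borel_measurable (restrict_space borel B)"
    by (rule Cc_measurable[OF f(1)], rule laplace_past_measurable[OF f(1) \<xi>])
  have "(\<integral>\<^sup>+x. ennreal ((1 - exp (- f x)) * laplace f (past \<xi> x)) * indicator (lc_part B) x \<partial>\<xi>) =
      (\<Sum>x\<in>?A. ennreal ((1 - exp (- f x)) * laplace f (past \<xi> x)) * indicator (lc_part B) x)"
  proof (rule nn_integral_Config[OF \<xi> D])
    show "(\<lambda>x. ennreal ((1 - exp (- f x)) * laplace f (past \<xi> x)) * indicator (lc_part B) x)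
        \<in> borel_measurable (restrict_space borel B)"
      by measurable
  qed simp
  also have "\<dots> = (\<Sum>x\<in>?A. ennreal ((1 - exp (- f x)) * exp (- (\<Sum>y\<in>{y \<in> ?A. lexless y x}. f y))))"
  proof (rule sum.cong)
    fix x assume x: "x \<in> ?A"
    have "(\<integral>y. f y \<partial>past \<xi> x) = (\<Sum>y\<in>atoms (past \<xi> x) \<inter> ?D. f y)"
      by (rule integral_Config[OF f(1) past_Config[OF \<xi>] D]) auto
    also have "atoms (past \<xi> x) \<inter> ?D = {y \<in> ?A. lexless y x}"
      by (auto simp: atoms_past[OF \<xi>])
    finally show "ennreal ((1 - exp (- f x)) * laplace f (past \<xi> x)) * indicator (lc_part B) x =
        ennreal ((1 - exp (- f x)) * exp (- (\<Sum>y\<in>{y \<in> ?A. lexless y x}. f y)))"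
      using x Cc_nonzero_lc_part[OF f(1), of x] by (simp add: laplace_def)
  qed simp
  also have "\<dots> = ennreal (\<Sum>x\<in>?A. (1 - exp (- f x)) * exp (- (\<Sum>y\<in>{y \<in> ?A. lexless y x}. f y)))"
    using f(2) by (intro sum_ennreal) auto
  also have "\<dots> = ennreal (1 - exp (- sum f ?A))"
    using finite_lex_telescope[OF finite_atoms[OF \<xi> D]] by simp
  also have "sum f ?A = (\<integral>x. f x \<partial>\<xi>)"
    by (rule integral_Config[OF f(1) \<xi> D, symmetric]) auto
  finally show ?thesis
    by (simp add: laplace_def)
qed

text \<open>The Campbell measure of \<open>P\<close>, restricted to points of
  \<open>lc_part B\<close> and transported by the map from \<open>(\<xi>, x)\<close> to
  \<open>(past \<xi> x, x)\<close>. The restriction is what makes the inner integral measurable in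
  \<open>\<xi>\<close>.\<close>

definition flux :: "'a::euclidean_space set \<Rightarrow> 'a measure measure \<Rightarrow> ('a measure \<times> 'a) measure" where
  "flux B P = measure_of (space (field_algebra B)) (sets (field_algebra B))
     (\<lambda>A. \<integral>\<^sup>+\<xi>. \<integral>\<^sup>+x. indicator A (past \<xi> x, x) * indicator (lc_part B) x \<partial>\<xi> \<partial>P)"

lemma sets_flux [simp]: "sets (flux B P) = sets (field_algebra B)"
  and space_flux [simp]: "space (flux B P) = space (field_algebra B)"
  by (simp_all add: flux_def)

lemma space_field_algebra: "space (field_algebra B) = Config B \<times> B"
  by (simp add: field_algebra_def space_pair_measure)

lemma flux_inner_measurable:
  assumes "h \<in> borel_measurable (field_algebra B)"
  shows "(\<lambda>\<xi>. \<integral>\<^sup>+x. h (past \<xi> x, x) * indicator (lc_part B) x \<partial>\<xi>) \<in> borel_measurable (config_algebra B)"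
proof -
  have "(\<lambda>p. h (past (fst p) (snd p), snd p)) \<in> borel_measurable (config_algebra B \<Otimes>\<^sub>M restrict_space borel B)"
    by (rule measurable_compose[OF past_pair_measurable assms])
  from kernel_measurable[OF config_kernel_id this] show ?thesis
    by simp
qed

lemma flux_section_measurable:
  assumes "h \<in> borel_measurable (field_algebra B)" "\<xi> \<in> Config B"
  shows "(\<lambda>x. h (past \<xi> x, x)) \<in> borel_measurable \<xi>"
proof -
  have "(\<lambda>p. h (past (fst p) (snd p), snd p)) \<in> borel_measurable (config_algebra B \<Otimes>\<^sub>M restrict_space borel B)"
    by (rule measurable_compose[OF past_pair_measurable assms(1)])
  from kernel_section_measurable[OF config_kernel_id _ this, of \<xi>] show ?thesis
    using assms(2) by simp
qed

lemma lc_part_indicator_measurable: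
  "\<xi> \<in> Config B \<Longrightarrow> (indicator (lc_part B) :: _ \<Rightarrow> ennreal) \<in> borel_measurable \<xi>"
  using lc_part_sets[of B] by (intro borel_measurable_indicator) (simp add: Config_sets)

lemma nn_integral_flux:
  assumes P: "sets P = sets (config_algebra B)" and h: "h \<in> borel_measurable (field_algebra B)"
  shows "(\<integral>\<^sup>+p. h p \<partial>flux B P) = (\<integral>\<^sup>+\<xi>. \<integral>\<^sup>+x. h (past \<xi> x, x) * indicator (lc_part B) x \<partial>\<xi> \<partial>P)"
proof -
  have sP: "space P = Config B"
    using sets_eq_imp_space_eq[OF P] by simp
  have Pm: "(\<lambda>\<xi>. \<integral>\<^sup>+x. h (past \<xi> x, x) * indicator (lc_part B) x \<partial>\<xi>) \<in> borel_measurable P"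
    if "h \<in> borel_measurable (field_algebra B)" for h
    using flux_inner_measurable[OF that] P by (simp cong: measurable_cong_sets)
  have sm: "(\<lambda>x. h (past \<xi> x, x) * indicator (lc_part B) x) \<in> borel_measurable \<xi>"
    if "h \<in> borel_measurable (field_algebra B)" "\<xi> \<in> Config B" for h :: "_ \<Rightarrow> ennreal" and \<xi>
    using that by (intro borel_measurable_times_ennreal flux_section_measurable lc_part_indicator_measurable)
  have cong: "(\<integral>\<^sup>+\<xi>. u \<xi> \<partial>P) = (\<integral>\<^sup>+\<xi>. v \<xi> \<partial>P)" if "\<And>\<xi>. \<xi> \<in> Config B \<Longrightarrow> u \<xi> = v \<xi>" for u v
    using that by (intro nn_integral_cong) (simp add: sP)
  \<comment> \<open>\<open>measure_of\<close> takes the prescribed values only once countable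
    additivity is known, which means exchanging a series with both integrals.\<close>
  have em: "emeasure (flux B P) A = (\<integral>\<^sup>+\<xi>. \<integral>\<^sup>+x. indicator A (past \<xi> x, x) * indicator (lc_part B) x \<partial>\<xi> \<partial>P)"
    if "A \<in> sets (field_algebra B)" for A
    unfolding flux_def
  proof (rule emeasure_measure_of_sigma)
    show "sigma_algebra (space (field_algebra B)) (sets (field_algebra B))"
      by (rule sets.sigma_algebra_axioms)
    show "positive (sets (field_algebra B))
      (\<lambda>A. \<integral>\<^sup>+\<xi>. \<integral>\<^sup>+x. indicator A (past \<xi> x, x) * indicator (lc_part B) x \<partial>\<xi> \<partial>P)"
      by (simp add: positive_def)
    show "countably_additive (sets (field_algebra B))
      (\<lambda>A. \<integral>\<^sup>+\<xi>. \<integral>\<^sup>+x. indicator A (past \<xi> x, x) * indicator (lc_part B) x \<partial>\<xi> \<partial>P)"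
    proof (rule countably_additiveI)
      fix A :: "nat \<Rightarrow> _"
      assume A: "range A \<subseteq> sets (field_algebra B)" "disjoint_family A"
      then have Ai: "(indicator (A i) :: _ \<Rightarrow> ennreal) \<in> borel_measurable (field_algebra B)" for i
        by auto
      have "(\<Sum>i. \<integral>\<^sup>+\<xi>. \<integral>\<^sup>+x. indicator (A i) (past \<xi> x, x) * indicator (lc_part B) x \<partial>\<xi> \<partial>P) =
        (\<integral>\<^sup>+\<xi>. (\<Sum>i. \<integral>\<^sup>+x. indicator (A i) (past \<xi> x, x) * indicator (lc_part B) x \<partial>\<xi>) \<partial>P)"
        using Pm[OF Ai] by (intro nn_integral_suminf[symmetric])
      also have "\<dots> = (\<integral>\<^sup>+\<xi>. \<integral>\<^sup>+x. (\<Sum>i. indicator (A i) (past \<xi> x, x) * indicator (lc_part B) x) \<partial>\<xi> \<partial>P)"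
        by (intro cong nn_integral_suminf[symmetric] sm[OF Ai])
      also have "\<dots> = (\<integral>\<^sup>+\<xi>. \<integral>\<^sup>+x. indicator (\<Union>i. A i) (past \<xi> x, x) * indicator (lc_part B) x \<partial>\<xi> \<partial>P)"
        by (simp add: ennreal_suminf_multc suminf_indicator[OF A(2)])
      finally show "(\<Sum>i. \<integral>\<^sup>+\<xi>. \<integral>\<^sup>+x. indicator (A i) (past \<xi> x, x) * indicator (lc_part B) x \<partial>\<xi> \<partial>P) =
        (\<integral>\<^sup>+\<xi>. \<integral>\<^sup>+x. indicator (\<Union>i. A i) (past \<xi> x, x) * indicator (lc_part B) x \<partial>\<xi> \<partial>P)" .
    qed
  qed (rule that)
  show ?thesis
    using h
  proof (induction rule: borel_measurable_induct)
    case (cong u v)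
    have "(\<integral>\<^sup>+p. u p \<partial>flux B P) = (\<integral>\<^sup>+p. v p \<partial>flux B P)"
      using cong(3) by (intro nn_integral_cong) simp
    moreover have "(\<integral>\<^sup>+\<xi>. \<integral>\<^sup>+x. u (past \<xi> x, x) * indicator (lc_part B) x \<partial>\<xi> \<partial>P) =
        (\<integral>\<^sup>+\<xi>. \<integral>\<^sup>+x. v (past \<xi> x, x) * indicator (lc_part B) x \<partial>\<xi> \<partial>P)"
    proof (intro nn_integral_cong)
      fix \<xi> x assume "\<xi> \<in> space P" "x \<in> space \<xi>"
      then have "(past \<xi> x, x) \<in> space (field_algebra B)"
        by (simp add: sP Config_space past_Config space_field_algebra)
      then show "u (past \<xi> x, x) * indicator (lc_part B) x = v (past \<xi> x, x) * indicator (lc_part B) x"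
        by (simp add: cong(3))
    qed
    ultimately show ?case
      using cong(4) by simp
  next
    case (set A)
    then show ?case
      by (simp add: em)
  next
    case (mult u c)
    have "(\<integral>\<^sup>+p. c * u p \<partial>flux B P) = c * (\<integral>\<^sup>+p. u p \<partial>flux B P)"
      using mult(2) by (intro nn_integral_cmult) (simp cong: measurable_cong_sets)
    also have "\<dots> = (\<integral>\<^sup>+\<xi>. c * (\<integral>\<^sup>+x. u (past \<xi> x, x) * indicator (lc_part B) x \<partial>\<xi>) \<partial>P)"
      unfolding mult(4) using Pm[OF mult(2)] by (intro nn_integral_cmult[symmetric])
    also have "\<dots> = (\<integral>\<^sup>+\<xi>. \<integral>\<^sup>+x. c * (u (past \<xi> x, x) * indicator (lc_part B) x) \<partial>\<xi> \<partial>P)"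
      by (intro cong nn_integral_cmult[symmetric] sm[OF mult(2)])
    finally show ?case
      by (simp add: mult.assoc)
  next
    case (add u v)
    have "(\<integral>\<^sup>+p. v p + u p \<partial>flux B P) = (\<integral>\<^sup>+p. v p \<partial>flux B P) + (\<integral>\<^sup>+p. u p \<partial>flux B P)"
      using add(1,3) by (intro nn_integral_add) (simp_all cong: measurable_cong_sets)
    also have "\<dots> = (\<integral>\<^sup>+\<xi>. (\<integral>\<^sup>+x. v (past \<xi> x, x) * indicator (lc_part B) x \<partial>\<xi>) +
        (\<integral>\<^sup>+x. u (past \<xi> x, x) * indicator (lc_part B) x \<partial>\<xi>) \<partial>P)"
      unfolding add(6,7) using Pm[OF add(1)] Pm[OF add(3)] by (intro nn_integral_add[symmetric])
    also have "\<dots> = (\<integral>\<^sup>+\<xi>. \<integral>\<^sup>+x. v (past \<xi> x, x) * indicator (lc_part B) x +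
        u (past \<xi> x, x) * indicator (lc_part B) x \<partial>\<xi> \<partial>P)"
      by (intro cong nn_integral_add[symmetric] sm[OF add(1)] sm[OF add(3)])
    finally show ?case
      by (simp add: distrib_right)
  next
    case (seq U)
    have inc: "U i p \<le> U j p" if "i \<le> j" for i j p
      using incseqD[OF seq(3) that] by (rule le_funD)
    have "(\<integral>\<^sup>+p. (SUP i. U i) p \<partial>flux B P) = (\<integral>\<^sup>+p. (SUP i. U i p) \<partial>flux B P)"
      by (simp add: SUP_apply image_comp)
    also have "\<dots> = (SUP i. \<integral>\<^sup>+p. U i p \<partial>flux B P)"
      using seq(1,3) by (intro nn_integral_monotone_convergence_SUP) (simp_all cong: measurable_cong_sets)
    also have "\<dots> = (SUP i. \<integral>\<^sup>+\<xi>. \<integral>\<^sup>+x. U i (past \<xi> x, x) * indicator (lc_part B) x \<partial>\<xi> \<partial>P)"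
      unfolding seq(5) ..
    also have "\<dots> = (\<integral>\<^sup>+\<xi>. (SUP i. \<integral>\<^sup>+x. U i (past \<xi> x, x) * indicator (lc_part B) x \<partial>\<xi>) \<partial>P)"
      using Pm[OF seq(1)] inc
      by (intro nn_integral_monotone_convergence_SUP[symmetric])
        (auto simp: incseq_def le_fun_def intro!: nn_integral_mono mult_right_mono)
    also have "\<dots> = (\<integral>\<^sup>+\<xi>. \<integral>\<^sup>+x. (SUP i. U i (past \<xi> x, x) * indicator (lc_part B) x) \<partial>\<xi> \<partial>P)"
      using inc
      by (intro cong nn_integral_monotone_convergence_SUP[symmetric] sm[OF seq(1)])
        (auto simp: incseq_def le_fun_def intro!: mult_right_mono)
    finally show ?case
      by (simp add: SUP_apply image_comp SUP_mult_right_ennreal)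
  qed
qed


section \<open>Laws of configurations\<close>

lemma P1_D:
  assumes "P \<in> P1 B"
  shows "prob_space P" "sets P = sets (config_algebra B)" "space P = Config B"
    "D \<in> bounded_borel B \<Longrightarrow> (\<integral>\<^sup>+\<xi>. emeasure \<xi> D \<partial>P) < \<infinity>"
  using assms sets_eq_imp_space_eq[of P "config_algebra B"] by (auto simp: P1_def)

lemma vague_continuous_measurable_P1:
  assumes "continuous_map (vague_topology B) euclideanreal F" "P \<in> P1 B"
  shows "F \<in> borel_measurable P"
  using vague_continuous_measurable[OF assms(1)] P1_D(2)[OF assms(2)]
  by (simp cong: measurable_cong_sets)

lemma integrable_sublinear_growth:
  assumes F: "continuous_map (vague_topology B) euclideanreal F" "sublinear_growth B F"
    and P: "P \<in> P1 B"
  shows "integrable P F"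
proof -
  interpret prob_space P
    by (rule P1_D(1)[OF P])
  obtain c f where c: "c > 0" and f: "f \<in> Cc B"
    and le: "\<And>\<xi>. \<xi> \<in> Config B \<Longrightarrow> \<bar>F \<xi>\<bar> \<le> c * (1 + (\<integral>x. f x \<partial>\<xi>))"
    using F(2) by (auto simp: sublinear_growth_def)
  obtain C where C: "C > 0" "\<And>x. x \<in> B \<Longrightarrow> \<bar>f x\<bar> \<le> C"
    using Cc_bounded[OF f] by blast
  let ?D = "{x \<in> B. f x \<noteq> 0}"
  have D: "?D \<in> bounded_borel B"
    by (rule Cc_supp[OF f])
  \<comment> \<open>Solving the growth bound for the number of atoms in \<open>?D\<close> gives a
    function of \<open>F\<close>, hence measurable, that lies below this number. Its integral can
    then be bounded without discussing measurability of the number itself, and \<open>F\<close> is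
    bounded in terms of \<open>u\<close>.\<close>
  define u where "u \<xi> = max 0 ((\<bar>F \<xi>\<bar> / c - 1) / C)" for \<xi>
  have [measurable]: "F \<in> borel_measurable P"
    by (rule vague_continuous_measurable_P1[OF F(1) P])
  then have [measurable]: "u \<in> borel_measurable P"
    unfolding u_def by measurable
  have u: "ennreal (u \<xi>) \<le> emeasure \<xi> ?D" if \<xi>: "\<xi> \<in> Config B" for \<xi>
  proof -
    have "(\<integral>x. f x \<partial>\<xi>) = (\<Sum>x\<in>atoms \<xi> \<inter> ?D. f x)"
      by (rule integral_Config[OF f \<xi> D]) auto
    also have "\<dots> \<le> (\<Sum>x\<in>atoms \<xi> \<inter> ?D. C)"
      using C(2) by (intro sum_mono) (auto simp: abs_le_iff)
    finally have "c * (1 + (\<integral>x. f x \<partial>\<xi>)) \<le> c * (1 + real (card (atoms \<xi> \<inter> ?D)) * C)"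
      using c by (intro mult_left_mono add_left_mono) simp_all
    with le[OF \<xi>] have "\<bar>F \<xi>\<bar> \<le> c * (1 + real (card (atoms \<xi> \<inter> ?D)) * C)"
      by linarith
    then have "(\<bar>F \<xi>\<bar> / c - 1) / C \<le> real (card (atoms \<xi> \<inter> ?D))"
      using c C(1) by (simp add: field_simps)
    then have "ennreal (u \<xi>) \<le> ennreal (real (card (atoms \<xi> \<inter> ?D)))"
      by (intro ennreal_leI) (simp add: u_def)
    then show ?thesis
      using emeasure_Config[OF \<xi> D] by (simp add: ennreal_of_nat_eq_real_of_nat)
  qed
  have "integrable P u"
  proof (rule integrableI_bounded)
    have "(\<integral>\<^sup>+\<xi>. ennreal (norm (u \<xi>)) \<partial>P) \<le> (\<integral>\<^sup>+\<xi>. emeasure \<xi> ?D \<partial>P)"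
      using u by (intro nn_integral_mono) (simp add: P1_D(3)[OF P], simp add: u_def)
    also have "\<dots> < \<infinity>"
      by (rule P1_D(4)[OF P D])
    finally show "(\<integral>\<^sup>+\<xi>. ennreal (norm (u \<xi>)) \<partial>P) < \<infinity>" .
  qed simp
  then have "integrable P (\<lambda>\<xi>. c * (1 + C * u \<xi>))"
    by simp
  then show ?thesis
  proof (rule Bochner_Integration.integrable_bound)
    have "\<bar>F \<xi>\<bar> \<le> c * (1 + C * u \<xi>)" for \<xi>
    proof -
      have "(\<bar>F \<xi>\<bar> / c - 1) / C \<le> u \<xi>"
        by (simp add: u_def)
      then show ?thesis
        using c C(1) by (simp add: field_simps)
    qed
    then show "AE \<xi> in P. norm (F \<xi>) \<le> norm (c * (1 + C * u \<xi>))"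
      by (intro AE_I2) (metis abs_ge_self order_trans real_norm_def)
  qed simp
qed

lemma laplace_continuous:
  assumes "f \<in> Cc B"
  shows "continuous_map (vague_topology B) euclideanreal (laplace f)"
proof -
  have "continuous_map euclideanreal euclideanreal (\<lambda>t :: real. exp (- t))"
    by (auto intro!: continuous_intros)
  from continuous_map_compose[OF vague_continuous_integral[OF assms] this] show ?thesis
    by (simp add: laplace_def[abs_def] o_def)
qed

lemma laplace_bounds:
  assumes "\<And>x. x \<in> B \<Longrightarrow> 0 \<le> f x" "\<xi> \<in> Config B"
  shows "0 \<le> laplace f \<xi>" "laplace f \<xi> \<le> 1"
  using assms by (auto simp: laplace_def Config_space intro!: integral_nonneg_AE AE_I2)

lemma laplace_integrable:
  assumes f: "f \<in> Cc B" "\<And>x. x \<in> B \<Longrightarrow> 0 \<le> f x" and P: "P \<in> P1 B"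
  shows "integrable P (laplace f)"
proof -
  interpret prob_space P
    by (rule P1_D(1)[OF P])
  show ?thesis
    using laplace_bounds[of B f] f(2)
    by (intro integrable_const_bound[where B = 1]
        vague_continuous_measurable_P1[OF laplace_continuous[OF f(1)] P] AE_I2)
      (auto simp: P1_D(3)[OF P])
qed

section \<open>The empty configuration and mixtures of laws\<close>

definition empty_law :: "'a::euclidean_space set \<Rightarrow> 'a measure measure" where
  "empty_law B = return (config_algebra B) (null_measure (restrict_space borel B))"

lemma null_measure_Config: "null_measure (restrict_space borel B) \<in> Config B"
  by (simp add: Config_def)

lemma empty_law_P1: "empty_law B \<in> P1 B"
  unfolding P1_def mem_Collect_eq
proof (intro conjI ballI)
  show "prob_space (empty_law B)"
    unfolding empty_law_def by (rule prob_space_return) (simp add: null_measure_Config)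
  show "sets (empty_law B) = sets (config_algebra B)"
    by (simp add: empty_law_def)
  fix D assume "D \<in> bounded_borel B"
  \<comment> \<open>The usual formula for integrals against a point mass needs a measurable
    integrand, so the bound is proved for each simple function below it.\<close>
  have "(\<integral>\<^sup>+\<xi>. emeasure \<xi> D \<partial>empty_law B) \<le> 0"
    unfolding nn_integral_def
  proof (rule SUP_least)
    fix g assume "g \<in> {g. simple_function (empty_law B) g \<and> g \<le> (\<lambda>\<xi>. emeasure \<xi> D)}"
    then have g: "simple_function (empty_law B) g" "g \<le> (\<lambda>\<xi>. emeasure \<xi> D)"
      by auto
    have "g \<in> borel_measurable (config_algebra B)"
      using borel_measurable_simple_function[OF g(1)] by (simp add: empty_law_def)
    then have "integral\<^sup>S (empty_law B) g = g (null_measure (restrict_space borel B))"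
      using nn_integral_eq_simple_integral[OF g(1)] null_measure_Config[of B]
      by (simp add: empty_law_def nn_integral_return)
    also have "\<dots> \<le> 0"
      using le_funD[OF g(2), of "null_measure (restrict_space borel B)"] by simp
    finally show "integral\<^sup>S (empty_law B) g \<le> 0" .
  qed
  then show "(\<integral>\<^sup>+\<xi>. emeasure \<xi> D \<partial>empty_law B) < \<infinity>"
    by (simp add: le_less_trans)
qed

lemma laplace_empty_law:
  assumes "f \<in> Cc B"
  shows "(\<integral>\<xi>. laplace f \<xi> \<partial>empty_law B) = 1"
  unfolding empty_law_def
  using null_measure_Config[of B] vague_continuous_measurable[OF laplace_continuous[OF assms]]
  by (subst integral_return) (auto simp: laplace_def)

definition mix :: "real \<Rightarrow> 'a measure \<Rightarrow> 'a measure \<Rightarrow> 'a measure" where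
  "mix s P Q = lincomb (ennreal (1 - s)) (ennreal s) P Q"

lemma mix_P1:
  assumes P: "P \<in> P1 B" and Q: "Q \<in> P1 B" and s: "s \<in> {0..1}"
  shows "mix s P Q \<in> P1 B"
  unfolding P1_def mem_Collect_eq
proof (intro conjI ballI)
  interpret P: prob_space P
    by (rule P1_D(1)[OF P])
  interpret Q: prob_space Q
    by (rule P1_D(1)[OF Q])
  have S: "sets Q = sets P"
    using P1_D(2)[OF P] P1_D(2)[OF Q] by simp
  have "emeasure Q (space P) = 1"
    using Q.emeasure_space_1 P1_D(3)[OF P] P1_D(3)[OF Q] by simp
  then show "prob_space (mix s P Q)"
    using s P.emeasure_space_1
    by (intro prob_spaceI) (simp add: mix_def emeasure_lincomb[OF S] flip: ennreal_plus)
  show "sets (mix s P Q) = sets (config_algebra B)"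
    using P1_D(2)[OF P] by (simp add: mix_def)
  fix D assume D: "D \<in> bounded_borel B"
  have "(\<integral>\<^sup>+\<xi>. emeasure \<xi> D \<partial>mix s P Q) \<le>
      ennreal (1 - s) * (\<integral>\<^sup>+\<xi>. emeasure \<xi> D \<partial>P) + ennreal s * (\<integral>\<^sup>+\<xi>. emeasure \<xi> D \<partial>Q)"
    unfolding mix_def by (rule nn_integral_lincomb_le[OF S])
  also have "\<dots> < \<infinity>"
    using P1_D(4)[OF P D] P1_D(4)[OF Q D] by (simp add: ennreal_mult_less_top)
  finally show "(\<integral>\<^sup>+\<xi>. emeasure \<xi> D \<partial>mix s P Q) < \<infinity>" .
qed

lemma integral_mix:
  fixes F :: "_ \<Rightarrow> real"
  assumes "P \<in> P1 B" "Q \<in> P1 B" "s \<in> {0..1}" "integrable P F" "integrable Q F"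
  shows "(\<integral>\<xi>. F \<xi> \<partial>mix s P Q) = (1 - s) * (\<integral>\<xi>. F \<xi> \<partial>P) + s * (\<integral>\<xi>. F \<xi> \<partial>Q)"
  unfolding mix_def
  using assms P1_D(2)[OF assms(1)] P1_D(2)[OF assms(2)] by (subst integrable_lincomb(2)) auto

lemma mix_0: "sets Q = sets P \<Longrightarrow> mix 0 P Q = P"
  by (rule measure_eqI) (auto simp: mix_def emeasure_lincomb)

lemma mix_1: "sets Q = sets P \<Longrightarrow> mix 1 P Q = Q"
  by (rule measure_eqI) (auto simp: mix_def emeasure_lincomb)


section \<open>Velocity fields with a constant density\<close>

text \<open>\<open>measure\<close> is 0 on sets of infinite mass. This is harmless: a locally
  bounded \<open>\<mu>\<close> is finite on \<open>local_sets B\<close>, and a field is only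
  evaluated there.\<close>

definition const_field :: "real \<Rightarrow> 'b measure \<Rightarrow> 'b set \<Rightarrow> real" where
  "const_field c \<mu> A = c * measure \<mu> A"

definition locally_bounded :: "'a::euclidean_space set \<Rightarrow> ('a measure \<times> 'a) measure \<Rightarrow> bool" where
  "locally_bounded B \<mu> \<longleftrightarrow> sets \<mu> = sets (field_algebra B) \<and>
     (\<forall>D\<in>bounded_borel B. emeasure \<mu> (Config B \<times> D) < \<infinity>)"

lemma Config_times_sets:
  "D \<in> sets (restrict_space borel B) \<Longrightarrow> Config B \<times> D \<in> sets (field_algebra B)"
  unfolding field_algebra_def using sets.top[of "config_algebra B"]
  by (intro pair_measureI) simp_all

lemma locally_bounded_local_sets:
  assumes \<mu>: "locally_bounded B \<mu>" and A: "A \<in> local_sets B"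
  shows "emeasure \<mu> A < \<infinity>"
proof -
  obtain D where D: "D \<in> bounded_borel B" "A \<subseteq> Config B \<times> D"
    using A by (auto simp: local_sets_def)
  then have "emeasure \<mu> A \<le> emeasure \<mu> (Config B \<times> D)"
    using \<mu> Config_times_sets[of D B]
    by (intro emeasure_mono) (auto simp: locally_bounded_def bounded_borel_def)
  also have "\<dots> < \<infinity>"
    using \<mu> D by (simp add: locally_bounded_def)
  finally show ?thesis .
qed

text \<open>For nonnegative \<open>c\<close> the set function is monotone, so the supremum is its
  value on all of \<open>A\<close>; for negative \<open>c\<close> both sides are 0 because
  \<open>ennreal\<close> truncates.\<close>

lemma upper_variation_const_field:
  assumes \<mu>: "locally_bounded B \<mu>" and A: "A \<in> sets (field_algebra B)"
  shows "upper_variation (local_sets B) (const_field c \<mu>) A = ennreal c * emeasure \<mu> A"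
proof -
  have sets: "sets \<mu> = sets (field_algebra B)"
    using \<mu> by (simp add: locally_bounded_def)
  have val: "ennreal (const_field c \<mu> C) = ennreal c * emeasure \<mu> C" if "C \<in> local_sets B" for C
    using locally_bounded_local_sets[OF \<mu> that]
    by (cases "c \<ge> 0")
      (auto simp: const_field_def ennreal_mult'' emeasure_eq_ennreal_measure ennreal_neg mult_nonpos_nonneg)
  have "upper_variation (local_sets B) (const_field c \<mu>) A =
      (SUP C\<in>{C \<in> local_sets B. C \<subseteq> A}. ennreal c * emeasure \<mu> C)"
    unfolding upper_variation_def by (rule SUP_cong) (auto simp: val)
  also have "\<dots> = ennreal c * emeasure \<mu> A"
  proof (rule antisym)
    show "(SUP C\<in>{C \<in> local_sets B. C \<subseteq> A}. ennreal c * emeasure \<mu> C) \<le> ennreal c * emeasure \<mu> A"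
      using A sets by (intro SUP_least mult_left_mono emeasure_mono) auto
    \<comment> \<open>\<open>A\<close> may extend over an unbounded part of \<open>B\<close> and
      then is not local itself; these pieces are local and exhaust it.\<close>
    define T where "T n = A \<inter> (Config B \<times> (B \<inter> ball 0 (real n)))" for n :: nat
    have Bn: "B \<inter> ball 0 (real n) \<in> bounded_borel B" for n
      by (rule ball_bounded_borel)
    have "Config B \<times> (B \<inter> ball 0 (real n)) \<in> sets (field_algebra B)" for n
      using Bn[of n] by (intro Config_times_sets) (simp add: bounded_borel_def)
    then have T: "T n \<in> sets (field_algebra B)" for n
      unfolding T_def using A by (intro sets.Int)
    have Tl: "T n \<in> local_sets B" "T n \<subseteq> A" for n
      unfolding local_sets_def using T[of n] Bn[of n] by (auto simp: T_def)
    have "A \<subseteq> Config B \<times> B"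
      using sets.sets_into_space[OF A] by (simp add: space_field_algebra)
    then have "(\<Union>n. T n) = A"
      by (auto simp: T_def reals_Archimedean2)
    moreover have "incseq T"
      by (auto simp: incseq_def T_def)
    ultimately have "emeasure \<mu> A = (SUP n. emeasure \<mu> (T n))"
      using SUP_emeasure_incseq[of T \<mu>] T sets by (simp add: image_subset_iff)
    then have "ennreal c * emeasure \<mu> A = (SUP n. ennreal c * emeasure \<mu> (T n))"
      by (simp add: SUP_mult_left_ennreal)
    also have "\<dots> \<le> (SUP C\<in>{C \<in> local_sets B. C \<subseteq> A}. ennreal c * emeasure \<mu> C)"
      using Tl by (intro SUP_mono) blast
    finally show "ennreal c * emeasure \<mu> A \<le> \<dots>" .
  qed
  finally show ?thesis .
qed

lemma lower_variation_const_field: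
  "lower_variation R (const_field c \<mu>) A = upper_variation R (const_field (- c) \<mu>) A"
  by (simp add: lower_variation_def upper_variation_def const_field_def)

lemma total_variation_const_field:
  assumes "locally_bounded B \<mu>" "A \<in> sets (field_algebra B)"
  shows "total_variation (local_sets B) (const_field c \<mu>) A = ennreal \<bar>c\<bar> * emeasure \<mu> A"
  unfolding total_variation_def lower_variation_const_field
  by (cases "c \<ge> 0") (simp_all add: upper_variation_const_field[OF assms] ennreal_neg)

lemma const_field_Mb0:
  assumes \<mu>: "locally_bounded B \<mu>"
  shows "const_field c \<mu> \<in> Mb0 B"
  unfolding Mb0_def mem_Collect_eq
proof (intro conjI ballI)
  show "signed_measure_on (local_sets B) (const_field c \<mu>)"
    unfolding signed_measure_on_def
  proof (intro conjI allI impI)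
    fix A :: "nat \<Rightarrow> _"
    assume A: "range A \<subseteq> local_sets B" "disjoint_family A" "(\<Union>n. A n) \<in> local_sets B"
    have "(\<lambda>n. measure \<mu> (A n)) sums measure \<mu> (\<Union>n. A n)"
      using A \<mu> locally_bounded_local_sets[OF \<mu> A(3)]
      by (intro measure_UNION) (auto simp: locally_bounded_def local_sets_def)
    then show "(\<lambda>n. const_field c \<mu> (A n)) sums const_field c \<mu> (\<Union>n. A n)"
      unfolding const_field_def by (rule sums_mult)
  qed (simp add: const_field_def)
  show "total_variation (local_sets B) (const_field c \<mu>) (Config B \<times> D) < \<infinity>"
    if D: "D \<in> bounded_borel B" for D
    using \<mu> D Config_times_sets[of D B]
    by (subst total_variation_const_field[OF \<mu>])
      (auto simp: bounded_borel_def locally_bounded_def ennreal_mult_less_top)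
qed

lemma field_integral_const_field:
  assumes \<mu>: "locally_bounded B \<mu>" and g: "integrable \<mu> g"
  shows "field_integral B (const_field c \<mu>) g = c * (\<integral>p. g p \<partial>\<mu>)"
proof -
  have sets: "sets \<mu> = sets (field_algebra B)"
    using \<mu> by (simp add: locally_bounded_def)
  \<comment> \<open>Proved for every real \<open>a\<close> because \<open>c\<close> gives the
    positive part and \<open>- c\<close> the negative one; of the two weights at least one truncates
    to 0. The zero second weight makes \<open>lincomb\<close> a plain rescaling.\<close>
  have pp: "measure_of (space (field_algebra B)) (sets (field_algebra B))
      (upper_variation (local_sets B) (const_field a \<mu>)) = lincomb (ennreal a) 0 \<mu> \<mu>" for a
    unfolding lincomb_def sets sets_eq_imp_space_eq[OF sets]
    by (rule measure_of_eq) (auto simp: sets.space_closed sets.sigma_sets_eq upper_variation_const_field[OF \<mu>])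
  have nn: "negative_part B (const_field c \<mu>) = lincomb (ennreal (- c)) 0 \<mu> \<mu>"
    unfolding negative_part_def pp[symmetric]
    by (rule arg_cong[where f = "measure_of _ _"]) (simp add: fun_eq_iff lower_variation_const_field)
  show ?thesis
    unfolding field_integral_def nn positive_part_def pp
    using g by (cases "c \<ge> 0") (simp_all add: integrable_lincomb(2) enn2real_eq_0_iff ennreal_neg)
qed


section \<open>Properties of the flux\<close>

text \<open>Forgetting the past and the restriction to \<open>lc_part B\<close> leaves at most the
  mean number of points in \<open>D\<close>, which is finite for laws in
  \<open>P1 B\<close>.\<close>

lemma flux_locally_bounded:
  assumes P: "P \<in> P1 B"
  shows "locally_bounded B (flux B P)"
  unfolding locally_bounded_def
proof (intro conjI ballI)
  fix D assume D: "D \<in> bounded_borel B"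
  then have Ds: "D \<in> sets (restrict_space borel B)" "Config B \<times> D \<in> sets (field_algebra B)"
    using Config_times_sets[of D B] by (auto simp: bounded_borel_def)
  have "emeasure (flux B P) (Config B \<times> D) = (\<integral>\<^sup>+p. indicator (Config B \<times> D) p \<partial>flux B P)"
    using Ds by simp
  also have "\<dots> = (\<integral>\<^sup>+\<xi>. \<integral>\<^sup>+x. indicator (Config B \<times> D) (past \<xi> x, x) * indicator (lc_part B) x \<partial>\<xi> \<partial>P)"
    using Ds by (intro nn_integral_flux P1_D(2)[OF P]) auto
  also have "\<dots> \<le> (\<integral>\<^sup>+\<xi>. emeasure \<xi> D \<partial>P)"
  proof (rule nn_integral_mono)
    fix \<xi> assume "\<xi> \<in> space P"
    then have \<xi>: "\<xi> \<in> Config B"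
      by (simp add: P1_D(3)[OF P])
    have "(\<integral>\<^sup>+x. indicator (Config B \<times> D) (past \<xi> x, x) * indicator (lc_part B) x \<partial>\<xi>) \<le>
        (\<integral>\<^sup>+x. indicator D x \<partial>\<xi>)"
      by (intro nn_integral_mono) (auto simp: indicator_def)
    then show "(\<integral>\<^sup>+x. indicator (Config B \<times> D) (past \<xi> x, x) * indicator (lc_part B) x \<partial>\<xi>) \<le> emeasure \<xi> D"
      using Ds(1) \<xi> by (simp add: Config_sets)
  qed
  also have "\<dots> < \<infinity>"
    by (rule P1_D(4)[OF P D])
  finally show "emeasure (flux B P) (Config B \<times> D) < \<infinity>" .
qed simp

text \<open>The telescoping identity, averaged over \<open>P\<close>. The constant 1 is the value of
  \<open>laplace f\<close> at the empty configuration, so the flux accounts exactly for the passage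
  from \<open>empty_law B\<close> to \<open>P\<close>.\<close>

lemma flux_laplace:
  assumes f: "f \<in> Cc B" "\<And>x. x \<in> B \<Longrightarrow> 0 \<le> f x" and P: "P \<in> P1 B"
  shows "integrable (flux B P) (\<lambda>(\<xi>, z). diff_op z (laplace f) \<xi>)"
    and "(\<integral>p. (case p of (\<xi>, z) \<Rightarrow> diff_op z (laplace f) \<xi>) \<partial>flux B P) = (\<integral>\<xi>. laplace f \<xi> \<partial>P) - 1"
proof -
  interpret prob_space P
    by (rule P1_D(1)[OF P])
  \<comment> \<open>Adding a point lowers \<open>laplace f\<close>; the negative of the increment is
    nonnegative, so the computation stays with nonnegative integrals until the end.\<close>
  let ?k = "\<lambda>p. (1 - exp (- f (snd p))) * laplace f (fst p)"
  have k: "(\<lambda>p. (case p of (\<xi>, z) \<Rightarrow> diff_op z (laplace f) \<xi>)) p = - ?k p"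
    if "p \<in> space (flux B P)" for p
    using that diff_op_laplace[OF f(1)] by (auto simp: space_field_algebra)
  have [measurable]: "f \<in> borel_measurable (restrict_space borel B)"
    "laplace f \<in> borel_measurable (config_algebra B)"
    by (auto intro: Cc_measurable f(1) vague_continuous_measurable laplace_continuous)
  have km: "?k \<in> borel_measurable (field_algebra B)"
    unfolding field_algebra_def by measurable
  have k0: "0 \<le> ?k p" if "p \<in> space (flux B P)" for p
    using that f(2) laplace_bounds[of B f] by (auto simp: space_field_algebra intro!: mult_nonneg_nonneg)
  have "(\<integral>\<^sup>+p. ennreal (?k p) \<partial>flux B P) =
      (\<integral>\<^sup>+\<xi>. \<integral>\<^sup>+x. ennreal (?k (past \<xi> x, x)) * indicator (lc_part B) x \<partial>\<xi> \<partial>P)"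
    using km by (intro nn_integral_flux P1_D(2)[OF P]) simp
  also have "\<dots> = (\<integral>\<^sup>+\<xi>. ennreal (1 - laplace f \<xi>) \<partial>P)"
    using laplace_telescope[OF f] by (intro nn_integral_cong) (simp add: P1_D(3)[OF P])
  also have "\<dots> = ennreal (\<integral>\<xi>. 1 - laplace f \<xi> \<partial>P)"
    using laplace_integrable[OF f P] laplace_bounds[of B f] f(2)
    by (intro nn_integral_eq_integral) (auto simp: P1_D(3)[OF P])
  also have "(\<integral>\<xi>. 1 - laplace f \<xi> \<partial>P) = 1 - (\<integral>\<xi>. laplace f \<xi> \<partial>P)"
    using laplace_integrable[OF f P] by (simp add: prob_space)
  finally have nn: "(\<integral>\<^sup>+p. ennreal (?k p) \<partial>flux B P) = ennreal (1 - (\<integral>\<xi>. laplace f \<xi> \<partial>P))" .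
  have le: "(\<integral>\<xi>. laplace f \<xi> \<partial>P) \<le> 1"
  proof -
    have "(\<integral>\<xi>. laplace f \<xi> \<partial>P) \<le> (\<integral>\<xi>. 1 \<partial>P)"
      using laplace_bounds[of B f] f(2)
      by (intro integral_mono laplace_integrable[OF f P]) (auto simp: P1_D(3)[OF P])
    then show ?thesis
      by (simp add: prob_space)
  qed
  have kM: "?k \<in> borel_measurable (flux B P)"
    using km by (simp cong: measurable_cong_sets)
  have int: "integrable (flux B P) ?k"
    using kM k0 by (intro integrableI_nonneg AE_I2) (simp_all only: nn, simp_all)
  have "(\<integral>p. ?k p \<partial>flux B P) = 1 - (\<integral>\<xi>. laplace f \<xi> \<partial>P)"
    using le by (subst integral_eq_nn_integral[OF kM AE_I2[OF k0]]) (simp_all only: nn, simp_all)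
  moreover have "(\<integral>p. (case p of (\<xi>, z) \<Rightarrow> diff_op z (laplace f) \<xi>) \<partial>flux B P) = (\<integral>p. - ?k p \<partial>flux B P)"
    by (intro Bochner_Integration.integral_cong refl k)
  ultimately show "(\<integral>p. (case p of (\<xi>, z) \<Rightarrow> diff_op z (laplace f) \<xi>) \<partial>flux B P) = (\<integral>\<xi>. laplace f \<xi> \<partial>P) - 1"
    by simp
  have "integrable (flux B P) (\<lambda>p. - ?k p)"
    using int by simp
  then show "integrable (flux B P) (\<lambda>(\<xi>, z). diff_op z (laplace f) \<xi>)"
    by (subst Bochner_Integration.integrable_cong[OF refl k])
qed


section \<open>The interpolating curve\<close>

definition curve :: "'a::euclidean_space set \<Rightarrow> 'a measure measure \<Rightarrow> 'a measure measure \<Rightarrow> real \<Rightarrow> 'a measure measure" where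
  "curve B P Q t = (if t \<le> 1/2 then mix (2 * t) P (empty_law B) else mix (2 * t - 1) (empty_law B) Q)"

text \<open>The factor 2 is the speed of an affine segment run through in half a unit of time. The
  first half dismantles \<open>P\<close>, hence the negative sign.\<close>

definition velocity ::
    "'a::euclidean_space set \<Rightarrow> 'a measure measure \<Rightarrow> 'a measure measure \<Rightarrow> real \<Rightarrow> ('a measure \<times> 'a) set \<Rightarrow> real" where
  "velocity B P Q t = (if t \<le> 1/2 then const_field (- 2) (flux B P) else const_field 2 (flux B Q))"

lemma curve_P1:
  assumes "P \<in> P1 B" "Q \<in> P1 B" "t \<in> {0..1}"
  shows "curve B P Q t \<in> P1 B"
  using assms by (auto simp: curve_def intro!: mix_P1 empty_law_P1)

lemma curve_0: "P \<in> P1 B \<Longrightarrow> curve B P Q 0 = P"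
  by (simp add: curve_def mix_0 P1_D(2)[OF empty_law_P1] P1_D(2))

lemma curve_1: "Q \<in> P1 B \<Longrightarrow> curve B P Q 1 = Q"
  by (simp add: curve_def mix_1 P1_D(2)[OF empty_law_P1] P1_D(2))

text \<open>The maxima merge both halves into one formula that is visibly continuous in
  \<open>t\<close>, so nothing has to be glued at 1/2.\<close>

lemma integral_curve:
  fixes F :: "_ \<Rightarrow> real"
  assumes P: "P \<in> P1 B" and Q: "Q \<in> P1 B" and t: "t \<in> {0..1}"
    and F: "integrable P F" "integrable Q F" "integrable (empty_law B) F"
  shows "(\<integral>\<xi>. F \<xi> \<partial>curve B P Q t) = max 0 (1 - 2 * t) * (\<integral>\<xi>. F \<xi> \<partial>P) +
    (1 - max 0 (1 - 2 * t) - max 0 (2 * t - 1)) * (\<integral>\<xi>. F \<xi> \<partial>empty_law B) +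
    max 0 (2 * t - 1) * (\<integral>\<xi>. F \<xi> \<partial>Q)"
proof (cases "t \<le> 1/2")
  case True
  then show ?thesis
    using integral_mix[OF P empty_law_P1 _ F(1,3), of "2 * t"] t by (simp add: curve_def)
next
  case False
  then show ?thesis
    using integral_mix[OF empty_law_P1 Q _ F(3,2), of "2 * t - 1"] t by (simp add: curve_def)
qed

lemma continuous_map_curve:
  assumes P: "P \<in> P1 B" and Q: "Q \<in> P1 B"
  shows "continuous_map (top_of_set {0..1}) (P1_topology B) (curve B P Q)"
  unfolding P1_topology_def
proof (rule continuous_on_generated_topo)
  let ?S = "{{P \<in> P1 B. (\<integral>\<xi>. F \<xi> \<partial>P) \<in> U} | F U.
        continuous_map (vague_topology B) euclideanreal F \<and> sublinear_growth B F \<and> open U}"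
  fix G assume "G \<in> ?S"
  then obtain F U where G: "G = {P \<in> P1 B. (\<integral>\<xi>. F \<xi> \<partial>P) \<in> U}"
    and F: "continuous_map (vague_topology B) euclideanreal F" "sublinear_growth B F" and U: "open U"
    by blast
  define w where "w t = max 0 (1 - 2 * t) * (\<integral>\<xi>. F \<xi> \<partial>P) +
    (1 - max 0 (1 - 2 * t) - max 0 (2 * t - 1)) * (\<integral>\<xi>. F \<xi> \<partial>empty_law B) +
    max 0 (2 * t - 1) * (\<integral>\<xi>. F \<xi> \<partial>Q)" for t
  have w: "(\<integral>\<xi>. F \<xi> \<partial>curve B P Q t) = w t" if "t \<in> {0..1}" for t
    unfolding w_def by (intro integral_curve P Q that integrable_sublinear_growth[OF F] empty_law_P1)
  have "continuous_on {0..1} w"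
    unfolding w_def by (intro continuous_intros)
  then have "openin (top_of_set {0..1}) ({0..1} \<inter> w -` U)"
    using U by (rule continuous_openin_preimage_gen)
  moreover have "curve B P Q -` G \<inter> {0..1} = {0..1} \<inter> w -` U"
    using w curve_P1[OF P Q] by (auto simp: G)
  ultimately show "openin (top_of_set {0..1}) (curve B P Q -` G \<inter> topspace (top_of_set {0..1}))"
    by simp
next
  let ?S = "{{P \<in> P1 B. (\<integral>\<xi>. F \<xi> \<partial>P) \<in> U} | F U.
        continuous_map (vague_topology B) euclideanreal F \<and> sublinear_growth B F \<and> open U}"
  \<comment> \<open>The generators must also cover the curve: the zero functional with
    \<open>U = UNIV\<close> makes \<open>P1 B\<close> itself a generator.\<close>
  have "sublinear_growth B (\<lambda>_. 0)"
    unfolding sublinear_growth_def by (intro exI[of _ 1] conjI bexI[of _ "\<lambda>_. 0"]) (auto simp: Cc_def)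
  then have "P1 B \<in> ?S"
    by (intro CollectI exI[of _ "\<lambda>_. 0"] exI[of _ UNIV]) auto
  moreover have "curve B P Q ` topspace (top_of_set {0..1}) \<subseteq> P1 B"
    using curve_P1[OF P Q] by auto
  ultimately show "curve B P Q ` topspace (top_of_set {0..1}) \<subseteq> \<Union>?S"
    by (meson Union_upper order_trans)
qed

lemma velocity_Mb0:
  assumes "P \<in> P1 B" "Q \<in> P1 B"
  shows "velocity B P Q t \<in> Mb0 B"
  using assms by (simp add: velocity_def const_field_Mb0 flux_locally_bounded)

text \<open>\<open>L\<close> is continuous and has slope \<open>K\<close> except at 1/2, and the
  fundamental theorem of calculus tolerates one such point. The boundary terms vanish because the
  support of \<open>\<phi>\<close> lies inside the open interval.\<close>

lemma piecewise_affine_by_parts: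
  fixes l0 l1 :: real
  defines "L \<equiv> \<lambda>t. max 0 (1 - 2 * t) * l0 + (1 - max 0 (1 - 2 * t) - max 0 (2 * t - 1)) + max 0 (2 * t - 1) * l1"
    and "K \<equiv> \<lambda>t. if t \<le> 1/2 then - 2 * (l0 - 1) else 2 * (l1 - 1)"
  assumes \<phi>: "\<phi> \<in> Cc_smooth_01"
  shows "set_integrable lborel {0..1} (\<lambda>t. deriv \<phi> t * L t)"
    and "set_integrable lborel {0..1} (\<lambda>t. \<phi> t * K t)"
    and "(LBINT t:{0..1}. deriv \<phi> t * L t) + (LBINT t:{0..1}. \<phi> t * K t) = 0"
proof -
  have d: "\<phi> differentiable (at t)" "deriv \<phi> differentiable (at t)" for t
    using \<phi> spec[of "\<lambda>n. \<forall>t. (deriv ^^ n) \<phi> differentiable (at t)" 0]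
      spec[of "\<lambda>n. \<forall>t. (deriv ^^ n) \<phi> differentiable (at t)" 1] by (auto simp: Cc_smooth_01_def)
  have D: "(\<phi> has_real_derivative deriv \<phi> t) (at t)" for t
    using d(1)[of t] DERIV_deriv_iff_real_differentiable by blast
  have c: "continuous_on A \<phi>" "continuous_on A (deriv \<phi>)" for A
    using d by (auto intro!: continuous_at_imp_continuous_on differentiable_imp_continuous_within)
  have cL: "continuous_on A L" for A
    unfolding L_def by (intro continuous_intros)
  have "closure {t. \<phi> t \<noteq> 0} \<subseteq> {0<..<1}"
    using \<phi> by (simp add: Cc_smooth_01_def)
  then have z: "\<phi> 0 = 0" "\<phi> 1 = 0"
    using closure_subset[of "{t. \<phi> t \<noteq> 0}"] by force+
  show i1: "set_integrable lborel {0..1} (\<lambda>t. deriv \<phi> t * L t)"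
    by (intro borel_integrable_atLeastAtMost' continuous_on_mult c cL)
  \<comment> \<open>\<open>K\<close> jumps at 1/2, so integrability is shown on each side. The right
    piece omits 1/2, where \<open>K\<close> still has its left value.\<close>
  have "set_integrable lborel {0..1/2} (\<lambda>t. \<phi> t * (- 2 * (l0 - 1)))"
    by (intro borel_integrable_atLeastAtMost' continuous_on_mult c continuous_on_const)
  then have a: "set_integrable lborel {0..1/2} (\<lambda>t. \<phi> t * K t)"
    by (rule set_integrable_cong[THEN iffD1, rotated 3]) (auto simp: K_def)
  have "set_integrable lborel {0..1} (\<lambda>t. \<phi> t * (2 * (l1 - 1)))"
    by (intro borel_integrable_atLeastAtMost' continuous_on_mult c continuous_on_const)
  then have "set_integrable lborel {1/2<..1} (\<lambda>t. \<phi> t * (2 * (l1 - 1)))"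
    by (rule set_integrable_subset) auto
  then have b: "set_integrable lborel {1/2<..1} (\<lambda>t. \<phi> t * K t)"
    by (rule set_integrable_cong[THEN iffD1, rotated 3]) (auto simp: K_def)
  have "{0..1/2} \<union> {1/2<..1} = {0..1::real}"
    by auto
  with set_integrable_Un[OF a b] show i2: "set_integrable lborel {0..1} (\<lambda>t. \<phi> t * K t)"
    by simp
  have "((\<lambda>t. deriv \<phi> t * L t + \<phi> t * K t) has_integral \<phi> 1 * L 1 - \<phi> 0 * L 0) {0..1}"
  proof (rule fundamental_theorem_of_calculus_interior_strong)
    show "finite {1/2 :: real}" "(0::real) \<le> 1"
      by auto
    show "continuous_on {0..1} (\<lambda>t. \<phi> t * L t)"
      by (intro continuous_on_mult c cL)
    fix t :: real assume t: "t \<in> {0<..<1} - {1/2}"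
    have "(L has_real_derivative K t) (at t)"
    proof (cases "t < 1/2")
      case True
      have "((\<lambda>t. (1 - 2 * t) * l0 + 2 * t) has_real_derivative K t) (at t)"
        using True by (auto simp: K_def intro!: derivative_eq_intros)
      then show ?thesis
        by (rule has_field_derivative_transform_within_open[where S = "{..<1/2}"]) (use True in \<open>auto simp: L_def\<close>)
    next
      case False
      have "((\<lambda>t. (2 - 2 * t) + (2 * t - 1) * l1) has_real_derivative K t) (at t)"
        using False t by (auto simp: K_def intro!: derivative_eq_intros)
      then show ?thesis
        by (rule has_field_derivative_transform_within_open[where S = "{1/2<..}"]) (use False t in \<open>auto simp: L_def\<close>)
    qed
    then have "((\<lambda>t. \<phi> t * L t) has_real_derivative (deriv \<phi> t * L t + \<phi> t * K t)) (at t)"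
      using DERIV_mult[OF D[of t], of L "K t"] by (simp add: mult.commute)
    then show "((\<lambda>t. \<phi> t * L t) has_vector_derivative (deriv \<phi> t * L t + \<phi> t * K t)) (at t)"
      by (simp add: has_real_derivative_iff_has_vector_derivative)
  qed
  then have "integral {0..1} (\<lambda>t. deriv \<phi> t * L t + \<phi> t * K t) = 0"
    using z by (simp add: integral_unique)
  moreover have "(LBINT t:{0..1}. deriv \<phi> t * L t + \<phi> t * K t) =
      integral {0..1} (\<lambda>t. deriv \<phi> t * L t + \<phi> t * K t)"
    by (rule set_borel_integral_eq_integral(2)[OF set_integral_add(1)[OF i1 i2]])
  ultimately show "(LBINT t:{0..1}. deriv \<phi> t * L t) + (LBINT t:{0..1}. \<phi> t * K t) = 0"
    using set_integral_add(2)[OF i1 i2] by simp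
qed

text \<open>For fixed \<open>f\<close> the equation is a scalar one: the mean of
  \<open>laplace f\<close> is piecewise affine in time and the field integral is its slope. The
  variation of the field is constant on each half, hence integrable in time.\<close>

lemma curve_CE:
  assumes P: "P \<in> P1 B" and Q: "Q \<in> P1 B"
  shows "(curve B P Q, velocity B P Q) \<in> CE B P Q"
  unfolding CE_def mem_Collect_eq case_prod_conv
proof (intro conjI ballI impI)
  fix \<phi> f assume \<phi>: "\<phi> \<in> Cc_smooth_01" and f: "f \<in> Cc B" and "\<forall>x\<in>B. 0 \<le> f x"
  then have f0: "\<And>x. x \<in> B \<Longrightarrow> 0 \<le> f x"
    by blast
  define l0 where "l0 = (\<integral>\<xi>. laplace f \<xi> \<partial>P)"
  define l1 where "l1 = (\<integral>\<xi>. laplace f \<xi> \<partial>Q)"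
  let ?L = "\<lambda>t. max 0 (1 - 2 * t) * l0 + (1 - max 0 (1 - 2 * t) - max 0 (2 * t - 1)) + max 0 (2 * t - 1) * l1"
  let ?K = "\<lambda>t. if t \<le> 1/2 then - 2 * (l0 - 1) else 2 * (l1 - 1)"
  have L: "(\<integral>\<xi>. laplace f \<xi> \<partial>curve B P Q t) = ?L t" if "t \<in> {0..1}" for t
    using integral_curve[OF P Q that laplace_integrable[OF f f0 P] laplace_integrable[OF f f0 Q]
        laplace_integrable[OF f f0 empty_law_P1]]
    by (simp add: laplace_empty_law[OF f] l0_def l1_def)
  have K: "field_integral B (velocity B P Q t) (\<lambda>(\<xi>, z). diff_op z (laplace f) \<xi>) = ?K t" for t
    using field_integral_const_field[OF flux_locally_bounded[OF P] flux_laplace(1)[OF f f0 P]]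
      field_integral_const_field[OF flux_locally_bounded[OF Q] flux_laplace(1)[OF f f0 Q]]
    by (simp add: velocity_def flux_laplace(2)[OF f f0 P] flux_laplace(2)[OF f f0 Q] l0_def l1_def)
  note parts = piecewise_affine_by_parts[OF \<phi>, of l0 l1]
  show "set_integrable lborel {0..1} (\<lambda>t. deriv \<phi> t * (\<integral>\<xi>. laplace f \<xi> \<partial>curve B P Q t))"
    using parts(1) by (rule set_integrable_cong[THEN iffD1, rotated 3]) (simp_all add: L)
  show "set_integrable lborel {0..1}
      (\<lambda>t. \<phi> t * field_integral B (velocity B P Q t) (\<lambda>(\<xi>, z). diff_op z (laplace f) \<xi>))"
    using parts(2) unfolding K .
  have "(LBINT t:{0..1}. deriv \<phi> t * (\<integral>\<xi>. laplace f \<xi> \<partial>curve B P Q t)) = (LBINT t:{0..1}. deriv \<phi> t * ?L t)"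
    by (rule set_lebesgue_integral_cong) (simp_all add: L)
  with parts(3) show "(LBINT t:{0..1}. deriv \<phi> t * (\<integral>\<xi>. laplace f \<xi> \<partial>curve B P Q t)) +
      (LBINT t:{0..1}. \<phi> t * field_integral B (velocity B P Q t) (\<lambda>(\<xi>, z). diff_op z (laplace f) \<xi>)) = 0"
    unfolding K by simp
next
  fix D assume D: "D \<in> bounded_borel B"
  have CD: "Config B \<times> D \<in> sets (field_algebra B)"
    using D by (intro Config_times_sets) (simp add: bounded_borel_def)
  define m where "m R = 2 * emeasure (flux B R) (Config B \<times> D)" for R
  have fin: "m P < \<infinity>" "m Q < \<infinity>"
    using flux_locally_bounded[OF P] flux_locally_bounded[OF Q] D
    by (auto simp: m_def locally_bounded_def ennreal_mult_less_top)
  have tv: "total_variation (local_sets B) (velocity B P Q t) (Config B \<times> D) = (if t \<le> 1/2 then m P else m Q)" for t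
    using flux_locally_bounded[OF P] flux_locally_bounded[OF Q] CD
    by (simp add: velocity_def total_variation_const_field m_def)
  show "(\<lambda>t. total_variation (local_sets B) (velocity B P Q t) (Config B \<times> D))
      \<in> borel_measurable (restrict_space lborel {0..1})"
    unfolding tv by (rule measurable_restrict_space1) measurable
  have "(\<integral>\<^sup>+t\<in>{0..1}. total_variation (local_sets B) (velocity B P Q t) (Config B \<times> D) \<partial>lborel) \<le>
      (\<integral>\<^sup>+t. (m P + m Q) * indicator {0..1} t \<partial>(lborel :: real measure))"
    unfolding tv by (intro nn_integral_mono) (auto simp: indicator_def add_increasing add_increasing2)
  also have "\<dots> = m P + m Q"
    by (simp add: nn_integral_cmult_indicator)
  also have "\<dots> < \<infinity>"
    using fin by simp
  finally show "(\<integral>\<^sup>+t\<in>{0..1}. total_variation (local_sets B) (velocity B P Q t) (Config B \<times> D) \<partial>lborel) < \<infinity>" .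
qed (use assms in \<open>auto intro: curve_P1 velocity_Mb0 curve_0 curve_1 continuous_map_curve\<close>)


section \<open>Stationarity\<close>

lemma Cc_shift: "f \<in> Cc UNIV \<Longrightarrow> (\<lambda>x. f (x - z)) \<in> Cc UNIV"
proof -
  assume f: "f \<in> Cc UNIV"
  let ?K = "closure {x. f x \<noteq> 0}"
  have cf: "continuous_on UNIV f" and cK: "compact ?K"
    using f by (auto simp: Cc_def)
  show ?thesis
  proof (rule CcI[where K = "(\<lambda>x. z + x) ` ?K"])
    show "continuous_on UNIV (\<lambda>x. f (x - z))"
      by (intro continuous_on_compose2[OF cf] continuous_intros) auto
    show "compact ((\<lambda>x. z + x) ` ?K)"
      by (intro compact_continuous_image continuous_intros cK)
    show "x \<in> (\<lambda>x. z + x) ` ?K" if "f (x - z) \<noteq> 0" for x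
      using that closure_subset[of "{x. f x \<noteq> 0}"] by (intro image_eqI[of _ _ "x - z"]) auto
  qed auto
qed

lemma Config_UNIV_sets: "\<xi> \<in> Config UNIV \<Longrightarrow> sets \<xi> = sets borel"
  using Config_sets[of \<xi> UNIV] by (simp add: sets_restrict_space)

lemma sets_shift [simp]: "sets (shift z \<xi>) = sets borel"
  by (simp add: shift_def)

lemma translation_measurable:
  "\<xi> \<in> Config UNIV \<Longrightarrow> (\<lambda>x. x - z) \<in> measurable \<xi> borel"
  using Config_UNIV_sets[of \<xi>] by (simp cong: measurable_cong_sets)

lemma emeasure_shift:
  assumes "\<xi> \<in> Config UNIV" "A \<in> sets borel"
  shows "emeasure (shift z \<xi>) A = emeasure \<xi> ((\<lambda>x. x - z) -` A)"
  unfolding shift_def using assms translation_measurable[OF assms(1)]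
  by (subst emeasure_distr) (auto simp: Config_space)

lemma nn_integral_shift:
  assumes "\<xi> \<in> Config UNIV" "h \<in> borel_measurable borel"
  shows "(\<integral>\<^sup>+x. h x \<partial>shift z \<xi>) = (\<integral>\<^sup>+x. h (x - z) \<partial>\<xi>)"
  unfolding shift_def using translation_measurable[OF assms(1)] assms(2) by (intro nn_integral_distr) auto

lemma shift_Config:
  assumes \<xi>: "\<xi> \<in> Config UNIV"
  shows "shift z \<xi> \<in> Config UNIV"
proof -
  have pre: "(\<lambda>x. x - z) -` D \<in> bounded_borel UNIV" if D: "D \<in> bounded_borel UNIV" for D
  proof -
    have "(\<lambda>x. x - z) -` D = (\<lambda>x. z + x) ` D"
      by (auto simp: image_iff intro!: bexI[of _ "_ - z"])
    moreover have "bounded ((\<lambda>x. z + x) ` D)"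
      using D by (intro bounded_translation) (simp add: bounded_borel_def)
    moreover have "(\<lambda>x. x - z) -` D \<in> sets borel"
      using D measurable_sets[of "\<lambda>x. x - z" borel borel D]
      by (simp add: bounded_borel_def sets_restrict_space)
    ultimately show ?thesis
      by (simp add: bounded_borel_def sets_restrict_space)
  qed
  have "emeasure (shift z \<xi>) D \<in> \<nat>" if D: "D \<in> bounded_borel UNIV" for D
    using Config_Nats[OF \<xi> pre[OF D]] D
    by (subst emeasure_shift[OF \<xi>]) (auto simp: bounded_borel_def sets_restrict_space)
  moreover have "emeasure (shift z \<xi>) {x} \<le> 1" for x
  proof -
    have "(\<lambda>x. x - z) -` {x} = {x + z}"
      by (auto simp: algebra_simps)
    then show ?thesis
      using \<xi> by (simp add: emeasure_shift[OF \<xi>] Config_def)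
  qed
  ultimately show ?thesis
    by (simp add: Config_def sets_restrict_space)
qed

text \<open>A translate of a test function is a test function, which reduces the claim to the
  identity kernel. It yields the measurability of \<open>shift z\<close>.\<close>

lemma config_kernel_shift: "config_kernel (config_algebra UNIV) UNIV (shift z)"
  unfolding config_kernel_def
proof (intro conjI ballI)
  fix f :: "'a \<Rightarrow> real" assume f: "f \<in> Cc UNIV"
  have fm: "f \<in> borel_measurable borel"
    using Cc_measurable[OF f] by (simp cong: measurable_cong_sets add: sets_restrict_space)
  have eq: "(\<integral>x. f x \<partial>shift z \<xi>) = (\<integral>x. f (x - z) \<partial>\<xi>)" if "\<xi> \<in> space (config_algebra UNIV)" for \<xi>
    unfolding shift_def using that by (intro integral_distr[OF translation_measurable fm]) simp
  show "(\<lambda>\<xi>. \<integral>x. f x \<partial>shift z \<xi>) \<in> borel_measurable (config_algebra UNIV)"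
    by (subst measurable_cong[OF eq]) (assumption, rule config_kernelD(2)[OF config_kernel_id Cc_shift[OF f]])
qed (simp add: shift_Config)

text \<open>Translation invariance of the order: \<open>y - z\<close> precedes \<open>x - z\<close>
  exactly when \<open>y\<close> precedes \<open>x\<close>.\<close>

lemma past_shift:
  assumes \<xi>: "\<xi> \<in> Config UNIV"
  shows "past (shift z \<xi>) (x - z) = shift z (past \<xi> x)"
proof (rule measure_eqI)
  fix A assume "A \<in> sets (past (shift z \<xi>) (x - z))"
  then have A: "A \<in> sets borel"
    by simp
  have A': "(\<lambda>y. y - z) -` A \<in> sets borel"
    using measurable_sets[OF _ A, of "\<lambda>y. y - z" borel] by simp
  have "emeasure (past (shift z \<xi>) (x - z)) A = emeasure (shift z \<xi>) (A \<inter> {y. lexless y (x - z)})"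
    using A by (intro emeasure_past[OF shift_Config[OF \<xi>]]) (simp add: sets_restrict_space)
  also have "\<dots> = emeasure \<xi> ((\<lambda>y. y - z) -` (A \<inter> {y. lexless y (x - z)}))"
    using A by (intro emeasure_shift \<xi>) simp
  also have "(\<lambda>y. y - z) -` (A \<inter> {y. lexless y (x - z)}) = (\<lambda>y. y - z) -` A \<inter> {y. lexless y x}"
    by auto
  also have "emeasure \<xi> \<dots> = emeasure (past \<xi> x) ((\<lambda>y. y - z) -` A)"
    using A' by (intro emeasure_past[OF \<xi>, symmetric]) (simp add: sets_restrict_space)
  also have "\<dots> = emeasure (shift z (past \<xi> x)) A"
    by (rule emeasure_shift[OF past_Config[OF \<xi>] A, symmetric])
  finally show "emeasure (past (shift z \<xi>) (x - z)) A = emeasure (shift z (past \<xi> x)) A" .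
qed simp

text \<open>Since taking the past commutes with shifts, the inner integral for the preimage of
  \<open>A\<close> at \<open>\<xi>\<close> is the one for \<open>A\<close> at
  \<open>shift z \<xi>\<close>. Invariance of \<open>P\<close> then removes the shift. On the whole
  space \<open>lc_part\<close> is everything, so its indicator disappears.\<close>

lemma flux_shift:
  assumes P: "P \<in> Ps" and A: "A \<in> sets (field_algebra UNIV)"
  shows "emeasure (flux UNIV P) {(\<xi>, x). \<xi> \<in> Config UNIV \<and> (shift z \<xi>, x - z) \<in> A} = emeasure (flux UNIV P) A"
proof -
  have P1: "P \<in> P1 UNIV" and inv: "distr P (config_algebra UNIV) (shift z) = P"
    using P by (auto simp: Ps_def)
  note sP = P1_D(2,3)[OF P1]
  let ?A = "{(\<xi>, x). \<xi> \<in> Config UNIV \<and> (shift z \<xi>, x - z) \<in> A}"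
  let ?G = "\<lambda>\<xi>. \<integral>\<^sup>+x. indicator A (past \<xi> x, x) \<partial>\<xi>"
  have sm: "shift z \<in> measurable (config_algebra UNIV) (config_algebra UNIV)"
    by (rule config_kernel_imp_measurable[OF config_kernel_shift])
  have "(\<lambda>p. (shift z (fst p), snd p - z)) \<in> measurable (field_algebra UNIV) (field_algebra UNIV)"
    unfolding field_algebra_def
    by (intro measurable_Pair measurable_compose[OF measurable_fst sm]) (simp add: sets_restrict_space cong: measurable_cong_sets)
  from measurable_sets[OF this A] have A': "?A \<in> sets (field_algebra UNIV)"
    by (simp add: vimage_def Int_def space_field_algebra split_beta' conj_commute mem_Times_iff)
  have Gm: "?G \<in> borel_measurable (config_algebra UNIV)"
    using flux_inner_measurable[of "indicator A" UNIV] A by simp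
  have ind: "(\<lambda>x. indicator A (past \<xi> x, x) :: ennreal) \<in> borel_measurable \<xi>" if "\<xi> \<in> Config UNIV" for \<xi>
    using that A by (intro flux_section_measurable) auto
  have fl: "emeasure (flux UNIV P) C = (\<integral>\<^sup>+\<xi>. \<integral>\<^sup>+x. indicator C (past \<xi> x, x) \<partial>\<xi> \<partial>P)"
    if "C \<in> sets (field_algebra UNIV)" for C
    using nn_integral_flux[OF sP(1), of "indicator C"] that by simp
  have "emeasure (flux UNIV P) ?A = (\<integral>\<^sup>+\<xi>. ?G (shift z \<xi>) \<partial>P)"
    unfolding fl[OF A']
  proof (rule nn_integral_cong)
    fix \<xi> assume "\<xi> \<in> space P"
    then have \<xi>: "\<xi> \<in> Config UNIV"
      by (simp add: sP)
    have "?G (shift z \<xi>) = (\<integral>\<^sup>+x. indicator A (past (shift z \<xi>) (x - z), x - z) \<partial>\<xi>)"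
      using ind[OF shift_Config[OF \<xi>, of z]]
      by (intro nn_integral_shift \<xi>) (simp cong: measurable_cong_sets)
    also have "\<dots> = (\<integral>\<^sup>+x. indicator ?A (past \<xi> x, x) \<partial>\<xi>)"
      using past_Config[OF \<xi>] by (intro nn_integral_cong) (simp add: past_shift[OF \<xi>] indicator_def)
    finally show "(\<integral>\<^sup>+x. indicator ?A (past \<xi> x, x) \<partial>\<xi>) = ?G (shift z \<xi>)" ..
  qed
  also have "\<dots> = (\<integral>\<^sup>+\<xi>. ?G \<xi> \<partial>distr P (config_algebra UNIV) (shift z))"
    using sm Gm sP(1) by (intro nn_integral_distr[symmetric]) (simp_all cong: measurable_cong_sets)
  also have "\<dots> = emeasure (flux UNIV P) A"
    unfolding inv fl[OF A] ..
  finally show ?thesis .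
qed

lemma const_field_flux_Ms:
  assumes "P \<in> Ps"
  shows "const_field c (flux UNIV P) \<in> Ms"
  unfolding Ms_def mem_Collect_eq
proof (intro conjI allI ballI)
  show "const_field c (flux UNIV P) \<in> Mb0 UNIV"
    using assms by (intro const_field_Mb0 flux_locally_bounded) (simp add: Ps_def)
  show "const_field c (flux UNIV P) {(\<xi>, x). \<xi> \<in> Config UNIV \<and> (shift z \<xi>, x - z) \<in> A} =
      const_field c (flux UNIV P) A" if "A \<in> local_sets UNIV" for z A
    using flux_shift[OF assms, of A z] that by (simp add: const_field_def measure_def local_sets_def)
qed

lemma curve_CEs:
  assumes "P \<in> Ps" "Q \<in> Ps"
  shows "(curve UNIV P Q, velocity UNIV P Q) \<in> CEs P Q"
  using assms curve_CE[of P UNIV Q]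
  by (auto simp: CEs_def velocity_def const_field_flux_Ms Ps_def)

thm_deps integral_Config kernel_measurable config_kernel_past nn_integral_flux flux_laplace curve_CEs

theorem theorem1p1:
  shows "(\<forall>B :: (real ^ 'd) set. B \<in> sets borel \<longrightarrow> polish_set B \<longrightarrow>
            (\<forall>P0 \<in> P1 B. \<forall>P1' \<in> P1 B. \<exists>P V. (P, V) \<in> CE B P0 P1'))
       \<and> (\<forall>P0 \<in> (Ps :: (real ^ 'd) measure measure set). \<forall>P1' \<in> Ps.
            \<exists>P V. (P, V) \<in> CEs P0 P1')"
  using curve_CE curve_CEs by blast

end
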